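(* Let $p$ be a probability mass function on $\mathbb{N}$ with $p_j=o(j^{-2})$ as $j\to\infty$, and let $\hat H(\mathbf{X}_n)$ be the harmonic entropy estimator computed from an i.i.d. sample of size $n$ from $p$. Then, as $n\to\infty$, $$\sqrt n\left(\hat H(\mathbf{X}_n)-H(X)\right)\ \longrightarrow\ \mathrm{N}\left(0,\operatorname{Var}[\log p(X)]\right)$$ in distribution.
   Context: $\mathbb{N}=\{1,2,3,\dots\}$ and $\log$ is the natural logarithm. For a probability mass function $p$ on $\mathbb{N}$ write $p_j=p(j)$; $X$ is a random variable with mass function $p$, with Shannon entropy $H(X)=-\mathbb{E}[\log p(X)]$. $J(m)=\sum_{k=1}^m 1/k$ is the $m$-th harmonic number, $J(0)=0$. Given an i.i.d. sample $\mathbf{X}_n=\{X^{(1)},\dots,X^{(n)}\}$ from $p$, let $m^{(i)}=\sum_{k=1}^n I(X^{(k)}=X^{(i)})$ be the number of occurrences of the symbol $X^{(i)}$ in the sample. The harmonic entropy estimator is $$\hat H(\mathbf{X}_n)=\frac1n\sum_{i=1}^n\left[J(n-1)-J\left(m^{(i)}-1\right)\right].$$ $\mathrm{N}(0,0)$ denotes the point mass at $0$. *)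

theory Defs
  imports "HOL-Probability.Probability" "HOL-Library.Landau_Symbols"
begin

text \<open>
  A sample of size \<open>n\<close> is the family \<open>x 1, \<dots>, x n\<close>; other values of \<open>x\<close> are irrelevant.
\<close>

definition occurrences :: "nat \<Rightarrow> (nat \<Rightarrow> 'b) \<Rightarrow> nat \<Rightarrow> nat" where
  "occurrences n x i = (\<Sum>k = 1..n. of_bool (x k = x i))"

definition harmonic_entropy_estimator :: "nat \<Rightarrow> (nat \<Rightarrow> 'b) \<Rightarrow> real" where
  "harmonic_entropy_estimator n x =
     1 / real n * (\<Sum>i = 1..n. harm (n - 1) - harm (occurrences n x i - 1))"

text \<open>
  In nats. The Bochner integral is \<open>0\<close> for a non-integrable function, so this is the
  Shannon entropy only when the latter is finite.
\<close>

definition shannon_entropy :: "'b pmf \<Rightarrow> real" where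
  "shannon_entropy p = - measure_pmf.expectation p (\<lambda>x. ln (pmf p x))"

text \<open>
  The normal law with mean \<open>\<mu>\<close> and variance \<open>v \<ge> 0\<close>. The case \<open>v = 0\<close> is separate because
  \<^const>\<open>normal_density\<close> is identically zero for standard deviation \<open>0\<close>.
\<close>

definition normal_law :: "real \<Rightarrow> real \<Rightarrow> real measure" where
  "normal_law \<mu> v =
     (if v = 0 then return borel \<mu> else density lborel (\<lambda>x. ennreal (normal_density \<mu> (sqrt v) x)))"

end

theory Submission
  imports Defs
begin

text \<open>
  Let \<open>F\<close> be \<open>n\<close> times the difference between the estimator and the empirical mean of \<open>- ln p(X\<^sub>i)\<close>.
  By the central limit theorem for \<open>- ln p(X\<^sub>i)\<close> it suffices that \<open>E F\<^sup>2 = o(n)\<close>; the two laws are then compared through characteristic functions.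

  Variance of \<open>F\<close>: deleting one observation with value \<open>x\<close> changes \<open>F\<close>, up to a constant, by
  \<open>D = J(n-1) - J(c) + ln p(x) + [c = 0]\<close>, where \<open>c\<close>, the number of other occurrences of \<open>x\<close>, is
  binomial with parameters \<open>n - 1\<close> and \<open>p(x)\<close>. The Efron--Stein inequality gives \<open>Var F \<le> n E D\<^sup>2\<close>, and
  \<open>E D\<^sup>2 \<rightarrow> 0\<close> by dominated convergence, because a second use of Efron--Stein yields
  \<open>Var J(c) \<le> E[1/c; c > 0]\<close>.

  Bias: \<open>J(m) - E J(Bin(m, q))\<close> is the sum of \<open>(1 - q)\<^sup>k / k\<close> over \<open>1 \<le> k \<le> m\<close>, a partial sum of the
  series of \<open>- ln q\<close>, so \<open>- E F / n\<close> is the sum of \<open>E[(1 - p(X))\<^sup>k] / k\<close> over \<open>k \<ge> n\<close>. The hypothesis on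
  \<open>p\<close> makes \<open>E[(1 - p(X))\<^sup>k] = o(1 / sqrt k)\<close>, and hence \<open>E F / n = o(1 / sqrt n)\<close>.
\<close>

section \<open>The Efron--Stein inequality for product distributions\<close>

text \<open>Tonelli's theorem. The power set of a product type can be larger than the product
  sigma-algebra, so the proof goes through \<open>nn_integral_pair_pmf'\<close> rather than a
  product measure. A finite iterated integral makes the inner integrals finite almost everywhere,
  which for a \<open>pmf\<close> means at every point of the support.\<close>

lemma
  fixes f :: "'a \<times> 'b \<Rightarrow> real"
  assumes int: "integrable (measure_pmf (pair_pmf A B)) f" and nonneg: "\<And>z. f z \<ge> 0"
  shows integrable_snd_pair_pmf_nonneg: "\<And>a. a \<in> set_pmf A \<Longrightarrow> integrable (measure_pmf B) (\<lambda>b. f (a, b))"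
    and integrable_integral_pair_pmf_nonneg: "integrable (measure_pmf A) (\<lambda>a. \<integral>b. f (a, b) \<partial>measure_pmf B)"
    and integral_pair_pmf_nonneg: "(\<integral>z. f z \<partial>measure_pmf (pair_pmf A B)) =
      (\<integral>a. \<integral>b. f (a, b) \<partial>measure_pmf B \<partial>measure_pmf A)"
proof -
  have fin: "(\<integral>\<^sup>+a. \<integral>\<^sup>+b. f (a, b) \<partial>measure_pmf B \<partial>measure_pmf A) < \<infinity>"
    using int nonneg by (simp add: integrable_iff_bounded nn_integral_pair_pmf')
  then have "AE a in measure_pmf A. (\<integral>\<^sup>+b. f (a, b) \<partial>measure_pmf B) \<noteq> \<infinity>"
    by (intro nn_integral_PInf_AE) auto
  then show inner: "integrable (measure_pmf B) (\<lambda>b. f (a, b))" if "a \<in> set_pmf A" for a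
    using that nonneg by (auto simp: AE_measure_pmf_iff integrable_iff_bounded less_top)
  have eq: "(\<integral>\<^sup>+a. ennreal (\<integral>b. f (a, b) \<partial>measure_pmf B) \<partial>measure_pmf A) =
      (\<integral>\<^sup>+a. \<integral>\<^sup>+b. f (a, b) \<partial>measure_pmf B \<partial>measure_pmf A)"
    by (intro nn_integral_cong_AE AE_pmfI) (simp add: nn_integral_eq_integral inner nonneg)
  with fin show int2: "integrable (measure_pmf A) (\<lambda>a. \<integral>b. f (a, b) \<partial>measure_pmf B)"
    by (simp add: integrable_iff_bounded nonneg)
  show "(\<integral>z. f z \<partial>measure_pmf (pair_pmf A B)) =
      (\<integral>a. \<integral>b. f (a, b) \<partial>measure_pmf B \<partial>measure_pmf A)"
    by (simp add: integral_eq_nn_integral nonneg nn_integral_pair_pmf' flip: eq)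
qed

text \<open>The signed case follows by splitting \<open>f\<close> into its positive and negative
  parts.\<close>

lemma
  fixes f :: "'a \<times> 'b \<Rightarrow> real"
  assumes int: "integrable (measure_pmf (pair_pmf A B)) f"
  shows integrable_snd_pair_pmf: "\<And>a. a \<in> set_pmf A \<Longrightarrow> integrable (measure_pmf B) (\<lambda>b. f (a, b))"
    and integrable_integral_pair_pmf: "integrable (measure_pmf A) (\<lambda>a. \<integral>b. f (a, b) \<partial>measure_pmf B)"
    and integral_pair_pmf: "(\<integral>z. f z \<partial>measure_pmf (pair_pmf A B)) =
      (\<integral>a. \<integral>b. f (a, b) \<partial>measure_pmf B \<partial>measure_pmf A)"
proof -
  let ?p = "\<lambda>z. max 0 (f z)" and ?n = "\<lambda>z. max 0 (- f z)"
  have f: "f z = ?p z - ?n z" for z by simp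
  have p: "integrable (measure_pmf (pair_pmf A B)) ?p" and n: "integrable (measure_pmf (pair_pmf A B)) ?n"
    using int by (auto intro!: integrable_max)
  note P = integrable_snd_pair_pmf_nonneg[OF p] integrable_snd_pair_pmf_nonneg[OF n]
  note I = integrable_integral_pair_pmf_nonneg[OF p] integrable_integral_pair_pmf_nonneg[OF n]
  show inner: "integrable (measure_pmf B) (\<lambda>b. f (a, b))" if "a \<in> set_pmf A" for a
    by (subst f) (use P that in auto)
  have eq: "(\<integral>b. f (a, b) \<partial>measure_pmf B) = (\<integral>b. ?p (a, b) \<partial>measure_pmf B) - (\<integral>b. ?n (a, b) \<partial>measure_pmf B)"
    if "a \<in> set_pmf A" for a
    by (subst f, rule Bochner_Integration.integral_diff) (use P that in auto)
  have "integrable (measure_pmf A) (\<lambda>a. (\<integral>b. ?p (a, b) \<partial>measure_pmf B) - (\<integral>b. ?n (a, b) \<partial>measure_pmf B))"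
    using I by auto
  then show "integrable (measure_pmf A) (\<lambda>a. \<integral>b. f (a, b) \<partial>measure_pmf B)"
    by (subst integrable_cong_AE) (auto simp: AE_measure_pmf_iff eq)
  have "(\<integral>z. f z \<partial>measure_pmf (pair_pmf A B)) =
    (\<integral>z. ?p z \<partial>measure_pmf (pair_pmf A B)) - (\<integral>z. ?n z \<partial>measure_pmf (pair_pmf A B))"
    using p n by (subst f, subst Bochner_Integration.integral_diff) auto
  also have "\<dots> = (\<integral>a. (\<integral>b. ?p (a, b) \<partial>measure_pmf B) - (\<integral>b. ?n (a, b) \<partial>measure_pmf B) \<partial>measure_pmf A)"
    using p n I by (subst (1 2) integral_pair_pmf_nonneg) auto
  also have "\<dots> = (\<integral>a. \<integral>b. f (a, b) \<partial>measure_pmf B \<partial>measure_pmf A)"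
    by (intro integral_cong_AE) (auto simp: AE_measure_pmf_iff eq)
  finally show "(\<integral>z. f z \<partial>measure_pmf (pair_pmf A B)) =
      (\<integral>a. \<integral>b. f (a, b) \<partial>measure_pmf B \<partial>measure_pmf A)" .
qed

lemma integrable_measure_pmf_of_square:
  fixes f :: "'a \<Rightarrow> real"
  shows "integrable (measure_pmf P) (\<lambda>x. (f x)\<^sup>2) \<Longrightarrow> integrable (measure_pmf P) f"
  by (rule measure_pmf.square_integrable_imp_integrable) auto

lemma square_add_le: "(a + b)\<^sup>2 \<le> 2 * a\<^sup>2 + 2 * (b :: real)\<^sup>2"
  using zero_le_power2[of "a - b"] unfolding power2_sum power2_diff by linarith

lemma square_integrable_add:
  fixes f g :: "'a \<Rightarrow> real"
  assumes [measurable]: "f \<in> borel_measurable M" "g \<in> borel_measurable M"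
    and "integrable M (\<lambda>x. (f x)\<^sup>2)" "integrable M (\<lambda>x. (g x)\<^sup>2)"
  shows "integrable M (\<lambda>x. (f x + g x)\<^sup>2)"
proof (rule Bochner_Integration.integrable_bound)
  show "integrable M (\<lambda>x. 2 * (f x)\<^sup>2 + 2 * (g x)\<^sup>2)" using assms by auto
  show "AE x in M. norm ((f x + g x)\<^sup>2) \<le> norm (2 * (f x)\<^sup>2 + 2 * (g x)\<^sup>2)"
    by (rule AE_I2) (simp add: square_add_le)
qed auto

lemma square_integrable_diff:
  fixes f g :: "'a \<Rightarrow> real"
  assumes "f \<in> borel_measurable M" "g \<in> borel_measurable M"
    and "integrable M (\<lambda>x. (f x)\<^sup>2)" "integrable M (\<lambda>x. (g x)\<^sup>2)"
  shows "integrable M (\<lambda>x. (f x - g x)\<^sup>2)"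
  using square_integrable_add[of f M "\<lambda>x. - g x"] assms by simp

lemma square_integrable_sum:
  fixes f :: "'i \<Rightarrow> 'a \<Rightarrow> real"
  assumes "\<And>i. i \<in> A \<Longrightarrow> f i \<in> borel_measurable M"
    and "\<And>i. i \<in> A \<Longrightarrow> integrable M (\<lambda>x. (f i x)\<^sup>2)"
  shows "integrable M (\<lambda>x. (\<Sum>i\<in>A. f i x)\<^sup>2)"
  using assms
  by (induction A rule: infinite_finite_induct) (auto intro!: square_integrable_add)

text \<open>On each fibre the squared mean is at most the mean square, because variances are
  nonnegative; integration over \<open>A\<close> shows that averaging contracts the L2 norm.\<close>

lemma
  fixes u :: "'a \<times> 'b \<Rightarrow> real"
  assumes int: "integrable (measure_pmf (pair_pmf A B)) (\<lambda>z. (u z)\<^sup>2)"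
  shows integrable_square_integral_pair_pmf:
      "integrable (measure_pmf A) (\<lambda>a. (\<integral>b. u (a, b) \<partial>measure_pmf B)\<^sup>2)"
    and integral_square_integral_pair_pmf_le:
      "(\<integral>a. (\<integral>b. u (a, b) \<partial>measure_pmf B)\<^sup>2 \<partial>measure_pmf A) \<le> (\<integral>z. (u z)\<^sup>2 \<partial>measure_pmf (pair_pmf A B))"
proof -
  have le: "(\<integral>b. u (a, b) \<partial>measure_pmf B)\<^sup>2 \<le> (\<integral>b. (u (a, b))\<^sup>2 \<partial>measure_pmf B)" if "a \<in> set_pmf A" for a
  proof -
    have i2: "integrable (measure_pmf B) (\<lambda>b. (u (a, b))\<^sup>2)"
      using integrable_snd_pair_pmf[OF int that] .
    show ?thesis
      using measure_pmf.variance_eq[OF integrable_measure_pmf_of_square[OF i2] i2]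
        measure_pmf.variance_positive[of B "\<lambda>b. u (a, b)"] by linarith
  qed
  note I = integrable_integral_pair_pmf[OF int]
  show i: "integrable (measure_pmf A) (\<lambda>a. (\<integral>b. u (a, b) \<partial>measure_pmf B)\<^sup>2)"
    by (rule Bochner_Integration.integrable_bound[OF I]) (auto simp: AE_measure_pmf_iff le)
  show "(\<integral>a. (\<integral>b. u (a, b) \<partial>measure_pmf B)\<^sup>2 \<partial>measure_pmf A) \<le> (\<integral>z. (u z)\<^sup>2 \<partial>measure_pmf (pair_pmf A B))"
    unfolding integral_pair_pmf[OF int]
    by (intro integral_mono_AE I i) (auto simp: AE_measure_pmf_iff le)
qed

text \<open>On each fibre the mean minimises the mean square distance among constants. The left-hand
  side is the expected conditional variance given the first component.\<close>

lemma conditional_variance_pair_pmf_le: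
  fixes f :: "'a \<times> 'b \<Rightarrow> real" and g :: "'a \<Rightarrow> real"
  assumes f: "integrable (measure_pmf (pair_pmf A B)) (\<lambda>z. (f z)\<^sup>2)"
    and fg: "integrable (measure_pmf (pair_pmf A B)) (\<lambda>z. (f z - g (fst z))\<^sup>2)"
  shows "(\<integral>z. (f z)\<^sup>2 \<partial>measure_pmf (pair_pmf A B))
      - (\<integral>a. (\<integral>b. f (a, b) \<partial>measure_pmf B)\<^sup>2 \<partial>measure_pmf A)
    \<le> (\<integral>z. (f z - g (fst z))\<^sup>2 \<partial>measure_pmf (pair_pmf A B))"
proof -
  note F = integrable_integral_pair_pmf[OF f] integrable_square_integral_pair_pmf[OF f]
  note G = integrable_integral_pair_pmf[OF fg]
  have le: "(\<integral>b. (f (a, b))\<^sup>2 \<partial>measure_pmf B) - (\<integral>b. f (a, b) \<partial>measure_pmf B)\<^sup>2 \<le>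
      (\<integral>b. (f (a, b) - g a)\<^sup>2 \<partial>measure_pmf B)" if "a \<in> set_pmf A" for a
  proof -
    have i2: "integrable (measure_pmf B) (\<lambda>b. (f (a, b))\<^sup>2)"
      using integrable_snd_pair_pmf[OF f that] .
    note i1 = integrable_measure_pmf_of_square[OF i2]
    have "(\<integral>b. (f (a, b) - g a)\<^sup>2 \<partial>measure_pmf B) =
      (\<integral>b. (f (a, b))\<^sup>2 + (g a)\<^sup>2 - 2 * f (a, b) * g a \<partial>measure_pmf B)"
      by (simp add: power2_diff)
    also have "\<dots> = (\<integral>b. (f (a, b))\<^sup>2 \<partial>measure_pmf B) + (g a)\<^sup>2
        - 2 * (\<integral>b. f (a, b) \<partial>measure_pmf B) * g a"
      using i1 i2 by simp
    finally show ?thesis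
      using zero_le_power2[of "(\<integral>b. f (a, b) \<partial>measure_pmf B) - g a"] unfolding power2_diff by linarith
  qed
  have "(\<integral>z. (f z)\<^sup>2 \<partial>measure_pmf (pair_pmf A B))
      - (\<integral>a. (\<integral>b. f (a, b) \<partial>measure_pmf B)\<^sup>2 \<partial>measure_pmf A) =
    (\<integral>a. (\<integral>b. (f (a, b))\<^sup>2 \<partial>measure_pmf B) - (\<integral>b. f (a, b) \<partial>measure_pmf B)\<^sup>2 \<partial>measure_pmf A)"
    using F by (simp add: integral_pair_pmf[OF f])
  also have "\<dots> \<le> (\<integral>a. \<integral>b. (f (a, b) - g a)\<^sup>2 \<partial>measure_pmf B \<partial>measure_pmf A)"
    using F G by (intro integral_mono_AE) (auto simp: AE_measure_pmf_iff le)
  also have "\<dots> = (\<integral>z. (f z - g (fst z))\<^sup>2 \<partial>measure_pmf (pair_pmf A B))"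
    by (simp add: integral_pair_pmf[OF fg])
  finally show ?thesis .
qed

section \<open>Efron--Stein by induction on the index set\<close>

lemma Pi_pmf_insert_swap:
  assumes "finite A" "k \<notin> A"
  shows "Pi_pmf (insert k A) d q = map_pmf (\<lambda>(x, y). x(k := y)) (pair_pmf (Pi_pmf A d q) (q k))"
  by (subst Pi_pmf_insert[OF assms], subst pair_commute_pmf)
     (simp add: pmf.map_comp o_def case_prod_unfold)

text \<open>Leave-one-out form: \<open>g i\<close> is any approximation of \<open>f\<close> that
  ignores coordinate \<open>i\<close>. Averaging out a new coordinate \<open>k\<close> splits the
  variance into an expected conditional variance, bounded by the term of \<open>g k\<close>, and the
  variance of the average, which the induction hypothesis controls.\<close>

theorem efron_stein_Pi_pmf:
  fixes f :: "('i \<Rightarrow> 'a) \<Rightarrow> real" and g :: "'i \<Rightarrow> ('i \<Rightarrow> 'a) \<Rightarrow> real"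
  assumes "finite A"
    and "integrable (measure_pmf (Pi_pmf A d q)) (\<lambda>x. (f x)\<^sup>2)"
    and "\<And>i. i \<in> A \<Longrightarrow> integrable (measure_pmf (Pi_pmf A d q)) (\<lambda>x. (g i x)\<^sup>2)"
    and "\<And>i x y. i \<in> A \<Longrightarrow> g i (x(i := y)) = g i x"
  shows "measure_pmf.variance (Pi_pmf A d q) f \<le>
    (\<Sum>i\<in>A. measure_pmf.expectation (Pi_pmf A d q) (\<lambda>x. (f x - g i x)\<^sup>2))"
  using assms
proof (induction A arbitrary: f g rule: finite_induct)
  case empty
  then show ?case by simp
next
  case (insert k A)
  let ?Q = "Pi_pmf A d q" and ?R = "Pi_pmf (insert k A) d q"
  let ?P = "pair_pmf ?Q (q k)"
  define u :: "('i \<Rightarrow> 'a) \<times> 'a \<Rightarrow> 'i \<Rightarrow> 'a" where "u = (\<lambda>(x, y). x(k := y))"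
  have R: "?R = map_pmf u ?P"
    unfolding u_def by (rule Pi_pmf_insert_swap) (use insert.hyps in auto)
  have f: "integrable (measure_pmf ?P) (\<lambda>z. (f (u z))\<^sup>2)"
    using insert.prems(1) unfolding R by simp
  have g: "integrable (measure_pmf ?P) (\<lambda>z. (g i (u z))\<^sup>2)" if "i \<in> insert k A" for i
    using insert.prems(2)[OF that] unfolding R by simp
  have fg: "integrable (measure_pmf ?P) (\<lambda>z. (f (u z) - g i (u z))\<^sup>2)" if "i \<in> insert k A" for i
    using f g[OF that] by (intro square_integrable_diff) auto
  \<comment> \<open>The induction hypothesis is applied to \<open>f\<close> and \<open>g i\<close>
    with coordinate \<open>k\<close> averaged out.\<close>
  define F where "F x = (\<integral>y. f (u (x, y)) \<partial>measure_pmf (q k))" for x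
  define G where "G i x = (\<integral>y. g i (u (x, y)) \<partial>measure_pmf (q k))" for i x
  have F2: "integrable (measure_pmf ?Q) (\<lambda>x. (F x)\<^sup>2)"
    unfolding F_def by (rule integrable_square_integral_pair_pmf[OF f])
  have G2: "integrable (measure_pmf ?Q) (\<lambda>x. (G i x)\<^sup>2)" if "i \<in> A" for i
    unfolding G_def by (rule integrable_square_integral_pair_pmf[OF g]) (use that in auto)
  have G_upd: "G i (x(i := y)) = G i x" if "i \<in> A" for i x y
  proof -
    have "(x(i := y))(k := z) = (x(k := z))(i := y)" for z
      using that insert.hyps by (auto simp: fun_upd_twist)
    moreover have "g i ((x(k := z))(i := y)) = g i (x(k := z))" for z
      using insert.prems(3)[OF insertI2[OF that], of "x(k := z)" y] .
    ultimately show ?thesis by (simp add: G_def u_def)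
  qed
  have "measure_pmf.variance ?Q F \<le> (\<Sum>i\<in>A. measure_pmf.expectation ?Q (\<lambda>x. (F x - G i x)\<^sup>2))"
    by (rule insert.IH[of F G, OF F2 G2 G_upd])
  \<comment> \<open>Averaging contracts the L2 norm, so the terms of \<open>F\<close> and
    \<open>G\<close> are dominated by those of \<open>f\<close> and \<open>g\<close>.\<close>
  also have "\<dots> \<le> (\<Sum>i\<in>A. measure_pmf.expectation ?R (\<lambda>x. (f x - g i x)\<^sup>2))"
  proof (intro sum_mono)
    fix i assume i: "i \<in> A"
    have eq: "F x - G i x = (\<integral>y. f (u (x, y)) - g i (u (x, y)) \<partial>measure_pmf (q k))" if "x \<in> set_pmf ?Q" for x
      unfolding F_def G_def
      by (rule Bochner_Integration.integral_diff[OF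
            integrable_measure_pmf_of_square[OF integrable_snd_pair_pmf[OF f that]]
            integrable_measure_pmf_of_square[OF integrable_snd_pair_pmf[OF g[OF insertI2[OF i]] that]],
            symmetric])
    have "measure_pmf.expectation ?Q (\<lambda>x. (F x - G i x)\<^sup>2) =
      measure_pmf.expectation ?Q (\<lambda>x. (\<integral>y. f (u (x, y)) - g i (u (x, y)) \<partial>measure_pmf (q k))\<^sup>2)"
      by (intro integral_cong_AE) (auto simp: AE_measure_pmf_iff eq)
    also have "\<dots> \<le> measure_pmf.expectation ?P (\<lambda>z. (f (u z) - g i (u z))\<^sup>2)"
      by (rule integral_square_integral_pair_pmf_le[OF fg]) (use i in auto)
    also have "\<dots> = measure_pmf.expectation ?R (\<lambda>x. (f x - g i x)\<^sup>2)"
      unfolding R by simp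
    finally show "measure_pmf.expectation ?Q (\<lambda>x. (F x - G i x)\<^sup>2) \<le>
      measure_pmf.expectation ?R (\<lambda>x. (f x - g i x)\<^sup>2)" .
  qed
  finally have rest: "measure_pmf.variance ?Q F \<le>
    (\<Sum>i\<in>A. measure_pmf.expectation ?R (\<lambda>x. (f x - g i x)\<^sup>2))" .
  \<comment> \<open>\<open>g k\<close> ignores coordinate \<open>k\<close> and therefore agrees with
    its own average.\<close>
  have gk: "g k (u z) = G k (fst z)" for z
  proof -
    have "g k (u (x, y)) = g k x" for x y
      unfolding u_def prod.case by (rule insert.prems(3)[OF insertI1])
    then show ?thesis by (cases z) (simp add: G_def)
  qed
  have first: "measure_pmf.expectation ?P (\<lambda>z. (f (u z))\<^sup>2) - measure_pmf.expectation ?Q (\<lambda>x. (F x)\<^sup>2)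
      \<le> measure_pmf.expectation ?R (\<lambda>x. (f x - g k x)\<^sup>2)"
    using conditional_variance_pair_pmf_le[OF f, of "G k"] fg[of k]
    unfolding R F_def by (simp add: gk)
  have mean: "measure_pmf.expectation ?R f = measure_pmf.expectation ?Q F"
    unfolding R F_def
    using integral_pair_pmf[OF integrable_measure_pmf_of_square[OF f]] by simp
  have "measure_pmf.variance ?R f = measure_pmf.expectation ?R (\<lambda>x. (f x)\<^sup>2) - (measure_pmf.expectation ?R f)\<^sup>2"
    by (rule measure_pmf.variance_eq[OF integrable_measure_pmf_of_square[OF insert.prems(1)] insert.prems(1)])
  \<comment> \<open>Law of total variance: \<open>f\<close> and \<open>F\<close> have the same mean,
    so the squared means cancel.\<close>
  also have "\<dots> = (measure_pmf.expectation ?P (\<lambda>z. (f (u z))\<^sup>2) - measure_pmf.expectation ?Q (\<lambda>x. (F x)\<^sup>2))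
     + measure_pmf.variance ?Q F"
    using measure_pmf.variance_eq[OF integrable_measure_pmf_of_square[OF F2] F2]
    by (simp add: mean) (simp add: R)
  also have "\<dots> \<le> measure_pmf.expectation ?R (\<lambda>x. (f x - g k x)\<^sup>2) +
      (\<Sum>i\<in>A. measure_pmf.expectation ?R (\<lambda>x. (f x - g i x)\<^sup>2))"
    using first rest by (rule add_mono)
  finally show ?case using insert.hyps by simp
qed


section \<open>Harmonic numbers of binomial variables\<close>

text \<open>The events \<open>x l = y\<close> for \<open>l\<close> in \<open>A\<close> are
  independent with probability \<open>pmf p y\<close>. Outside \<open>A\<close> the default
  \<open>d\<close> turns into the default \<open>d = y\<close> of the Boolean family.\<close>

lemma map_pmf_card_eq_Pi_pmf:
  assumes "finite A"
  shows "map_pmf (\<lambda>x. card {l\<in>A. x l = y}) (Pi_pmf A d (\<lambda>_. p)) = binomial_pmf (card A) (pmf p y)"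
proof -
  have b: "map_pmf (\<lambda>z. z = y) p = bernoulli_pmf (pmf p y)"
  proof (intro pmf_eqI)
    fix c
    have "pmf (map_pmf (\<lambda>z. z = y) p) True = pmf p y"
    proof -
      have "(\<lambda>z. z = y) -` {True} = {y}" by auto
      then show ?thesis by (simp add: pmf_map measure_pmf_single)
    qed
    moreover have "pmf (map_pmf (\<lambda>z. z = y) p) False = 1 - pmf p y"
    proof -
      have "(\<lambda>z. z = y) -` {False} = UNIV - {y}" by auto
      then show ?thesis
        using measure_pmf.prob_compl[of "{y}" p] by (simp add: pmf_map measure_pmf_single)
    qed
    ultimately show "pmf (map_pmf (\<lambda>z. z = y) p) c = pmf (bernoulli_pmf (pmf p y)) c"
      by (cases c) (auto simp: pmf_le_1)
  qed
  have "binomial_pmf (card A) (pmf p y) =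
    map_pmf (\<lambda>f. card {l\<in>A. f l}) (Pi_pmf A (d = y) (\<lambda>_. bernoulli_pmf (pmf p y)))"
    using assms by (intro binomial_pmf_altdef') (auto simp: pmf_le_1)
  also have "Pi_pmf A (d = y) (\<lambda>_. bernoulli_pmf (pmf p y)) =
    map_pmf (\<lambda>h. (\<lambda>z. z = y) \<circ> h) (Pi_pmf A d (\<lambda>_. p))"
    using assms b by (subst Pi_pmf_map[of A "\<lambda>z. z = y" d "d = y", symmetric]) auto
  finally show ?thesis by (simp add: pmf.map_comp o_def)
qed

context
  fixes q :: real
  assumes q: "q \<in> {0..1}"
begin

text \<open>Absorption, \<open>(m + 1) (m choose k) = (k + 1) (m + 1 choose k + 1)\<close>, turns
  the sum into a binomial sum of order \<open>m + 1\<close> without its term at \<open>0\<close>.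
  The factor \<open>q\<close> on the left admits \<open>q = 0\<close>.\<close>

lemma expectation_inverse_Suc_binomial:
  "q * measure_pmf.expectation (binomial_pmf m q) (\<lambda>k. 1 / real (Suc k)) =
    (1 - (1 - q) ^ Suc m) / real (Suc m)"
proof -
  have "real (Suc m) * (q * measure_pmf.expectation (binomial_pmf m q) (\<lambda>k. 1 / real (Suc k))) =
    (\<Sum>k\<le>m. real (Suc m) * (q * (real (m choose k) * q ^ k * (1 - q) ^ (m - k) * (1 / real (Suc k)))))"
    using q by (simp add: expectation_binomial_pmf' sum_distrib_left)
  also have "\<dots> = (\<Sum>k\<le>m. real (Suc m choose Suc k) * q ^ Suc k * (1 - q) ^ (Suc m - Suc k))"
  proof (intro sum.cong refl)
    fix k
    have "real (Suc m) * real (m choose k) = real (Suc k) * real (Suc m choose Suc k)"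
      by (metis Suc_times_binomial_eq mult.commute of_nat_mult)
    then have "real (Suc m) * real (m choose k) / real (Suc k) = real (Suc m choose Suc k)"
      by (simp add: field_simps del: of_nat_Suc)
    moreover have "real (Suc m) * (q * (real (m choose k) * q ^ k * (1 - q) ^ (m - k) * (1 / real (Suc k))))
      = (real (Suc m) * real (m choose k) / real (Suc k)) * q ^ Suc k * (1 - q) ^ (m - k)"
      by (simp del: of_nat_Suc)
    ultimately show "real (Suc m) * (q * (real (m choose k) * q ^ k * (1 - q) ^ (m - k) * (1 / real (Suc k))))
      = real (Suc m choose Suc k) * q ^ Suc k * (1 - q) ^ (Suc m - Suc k)"
      by simp
  qed
  also have "\<dots> = (\<Sum>k\<le>Suc m. real (Suc m choose k) * q ^ k * (1 - q) ^ (Suc m - k)) - (1 - q) ^ Suc m"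
    by (subst sum.atMost_Suc_shift) simp
  also have "\<dots> = 1 - (1 - q) ^ Suc m"
    using binomial_ring[of q "1 - q" "Suc m"] by simp
  finally show ?thesis by (simp add: field_simps del: of_nat_Suc)
qed

lemma expectation_binomial_pmf_Suc:
  fixes h :: "nat \<Rightarrow> real"
  shows "measure_pmf.expectation (binomial_pmf (Suc m) q) h =
    q * measure_pmf.expectation (binomial_pmf m q) (\<lambda>k. h (Suc k)) +
    (1 - q) * measure_pmf.expectation (binomial_pmf m q) h"
proof -
  have "binomial_pmf (Suc m) q =
    map_pmf (\<lambda>(b, k). (if b then 1 else 0) + k) (pair_pmf (bernoulli_pmf q) (binomial_pmf m q))"
    by (subst binomial_pmf_Suc[OF q]) (simp add: pair_pmf_def map_bind_pmf)
  moreover have "integrable (measure_pmf (pair_pmf (bernoulli_pmf q) (binomial_pmf m q))) f"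
    for f :: "bool \<times> nat \<Rightarrow> real"
    using q by (intro integrable_measure_pmf_finite) (auto simp: set_pmf_binomial_eq)
  ultimately show ?thesis
    using q by (simp add: integral_pair_pmf case_prod_unfold)
qed

text \<open>One more trial is a success with probability \<open>q\<close> and then raises the
  harmonic number by \<open>1 / (k + 1)\<close>, whose mean is known exactly. For
  \<open>q > 0\<close> the subtracted sum is a partial sum of the series of \<open>- ln q\<close>;
  this is what makes harmonic numbers nearly unbiased for logarithms.\<close>

lemma expectation_harm_binomial:
  "measure_pmf.expectation (binomial_pmf m q) (harm :: nat \<Rightarrow> real) =
    harm m - (\<Sum>k = 1..m. (1 - q) ^ k / real k)"
proof (induction m)
  case 0
  then show ?case using q by (simp add: binomial_pmf_0 harm_def)
next
  case (Suc m)
  have i: "integrable (measure_pmf (binomial_pmf m q)) f" for f :: "nat \<Rightarrow> real"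
    using q by auto
  have "measure_pmf.expectation (binomial_pmf (Suc m) q) (harm :: nat \<Rightarrow> real) =
    measure_pmf.expectation (binomial_pmf m q) harm +
    q * measure_pmf.expectation (binomial_pmf m q) (\<lambda>k. 1 / real (Suc k))"
    using i by (simp add: expectation_binomial_pmf_Suc harm_Suc inverse_eq_divide algebra_simps
        del: of_nat_Suc)
  also have "\<dots> = harm (Suc m) - (\<Sum>k = 1..Suc m. (1 - q) ^ k / real k)"
    by (simp add: Suc expectation_inverse_Suc_binomial harm_Suc inverse_eq_divide diff_divide_distrib
        del: of_nat_Suc power_Suc)
  finally show ?case .
qed

text \<open>Here and below \<open>1 / 0 = 0\<close>, so the value \<open>0\<close> does not contribute.\<close>

lemma expectation_inverse_binomial_le:
  "q * measure_pmf.expectation (binomial_pmf m q) (\<lambda>k. 1 / real k) \<le> 2 / real (Suc m)"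
proof -
  have "measure_pmf.expectation (binomial_pmf m q) (\<lambda>k. 1 / real k) \<le>
    measure_pmf.expectation (binomial_pmf m q) (\<lambda>k. 2 * (1 / real (Suc k)))"
  proof (intro integral_mono)
    \<comment> \<open>For \<open>k = 0\<close> the left-hand side is \<open>0\<close>; otherwise
      \<open>k + 1 \<le> 2 * k\<close>.\<close>
    show "1 / real k \<le> 2 * (1 / real (Suc k))" for k
      by (cases k) (auto simp: field_simps)
  qed (use q in auto)
  also have "\<dots> = 2 * measure_pmf.expectation (binomial_pmf m q) (\<lambda>k. 1 / real (Suc k))"
    by (rule integral_mult_right_zero)
  finally have "q * measure_pmf.expectation (binomial_pmf m q) (\<lambda>k. 1 / real k) \<le>
    q * (2 * measure_pmf.expectation (binomial_pmf m q) (\<lambda>k. 1 / real (Suc k)))"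
    using q by (intro mult_left_mono) auto
  also have "\<dots> = 2 * ((1 - (1 - q) ^ Suc m) / real (Suc m))"
    by (simp only: mult.left_commute[of q] expectation_inverse_Suc_binomial)
  also have "\<dots> \<le> 2 / real (Suc m)"
    using q by (auto simp: divide_simps)
  finally show ?thesis .
qed

text \<open>Efron--Stein for the count \<open>N\<close> of successes, where \<open>g i\<close>
  leaves out trial \<open>i\<close>. A successful trial changes the harmonic number by its last term
  \<open>1 / N\<close> and a failure changes nothing, so the \<open>N\<close> squared changes add up
  to \<open>1 / N\<close>.\<close>

lemma variance_harm_binomial_le:
  "measure_pmf.variance (binomial_pmf m q) (harm :: nat \<Rightarrow> real) \<le>
    measure_pmf.expectation (binomial_pmf m q) (\<lambda>k. 1 / real k)"
proof -
  define P where "P = Pi_pmf {..<m} False (\<lambda>_. bernoulli_pmf q)"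
  define N where "N x = card {l\<in>{..<m}. x l}" for x :: "nat \<Rightarrow> bool"
  define g where "g i x = (harm (card {l\<in>{..<m} - {i}. x l}) :: real)" for i and x :: "nat \<Rightarrow> bool"
  have B: "binomial_pmf m q = map_pmf N P"
    unfolding P_def N_def by (rule binomial_pmf_altdef') (use q in auto)
  have "finite (set_pmf P)"
    unfolding P_def by (subst set_Pi_pmf) (auto intro!: finite_PiE_dflt)
  then have i: "integrable (measure_pmf P) f" for f :: "_ \<Rightarrow> real"
    by (rule integrable_measure_pmf_finite)
  have diff: "(harm (N x) - g i x)\<^sup>2 = (if x i then (1 / real (N x))\<^sup>2 else 0)" if "i < m" for i x
  proof (cases "x i")
    case True
    have "{l\<in>{..<m}. x l} = insert i {l\<in>{..<m} - {i}. x l}" using that True by auto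
    then have "N x = Suc (card {l\<in>{..<m} - {i}. x l})" unfolding N_def by simp
    then show ?thesis using True by (simp add: g_def harm_Suc inverse_eq_divide)
  next
    case False
    then have "{l\<in>{..<m}. x l} = {l\<in>{..<m} - {i}. x l}" by auto
    then show ?thesis using False by (simp add: g_def N_def)
  qed
  have "measure_pmf.variance P (\<lambda>x. harm (N x)) \<le>
    (\<Sum>i<m. measure_pmf.expectation P (\<lambda>x. (harm (N x) - g i x)\<^sup>2))"
    unfolding P_def
  proof (rule efron_stein_Pi_pmf, goal_cases)
    case (4 i x y)
    have "{l\<in>{..<m} - {i}. (x(i := y)) l} = {l\<in>{..<m} - {i}. x l}" by auto
    then show ?case unfolding g_def by simp
  qed (use i in \<open>simp_all add: P_def\<close>)
  also have "\<dots> = measure_pmf.expectation P (\<lambda>x. \<Sum>i<m. (harm (N x) - g i x)\<^sup>2)"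
    using i by simp
  also have "\<dots> = measure_pmf.expectation P (\<lambda>x. 1 / real (N x))"
  proof (intro arg_cong[where f = "measure_pmf.expectation P"] ext)
    fix x
    have "(\<Sum>i<m. (harm (N x) - g i x)\<^sup>2) = (\<Sum>i<m. if x i then (1 / real (N x))\<^sup>2 else 0)"
      by (intro sum.cong) (auto simp: diff)
    also have "\<dots> = (\<Sum>i | i \<in> {..<m} \<and> x i. (1 / real (N x))\<^sup>2)"
      by (subst sum.inter_filter) auto
    also have "\<dots> = 1 / real (N x)"
      by (simp add: N_def power2_eq_square)
    finally show "(\<Sum>i<m. (harm (N x) - g i x)\<^sup>2) = 1 / real (N x)" .
  qed
  finally show ?thesis by (simp add: B)
qed

end

section \<open>Remainders of the logarithmic series\<close>

text \<open>The remainder after \<open>m\<close> terms of \<open>- ln q = \<Sum>\<^sub>k (1 - q)\<^sup>k / k\<close>.\<close>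

definition log_tail :: "nat \<Rightarrow> real \<Rightarrow> real" where
  "log_tail m q = - ln q - (\<Sum>k = 1..m. (1 - q) ^ k / real k)"

lemma log_tail_sums:
  assumes "0 < q" "q \<le> 1"
  shows "(\<lambda>k. (1 - q) ^ (k + m + 1) / real (k + m + 1)) sums log_tail m q"
proof -
  define g where "g n = (1 - q) ^ n / real n" for n
  have g: "summable g"
    using norm_summable_ln_series[of "1 - q"] assms
    by (intro summable_norm_cancel[of g]) (simp add: g_def)
  have "ln q = (\<Sum>n. (- 1) ^ n * (1 / real (n + 1)) * (q - 1) ^ Suc n)"
    using assms by (intro ln_series) auto
  \<comment> \<open>Written in powers of \<open>1 - q\<close> instead of \<open>q - 1\<close>, the
    alternating series loses its signs.\<close>
  also have "(\<lambda>n. (- 1) ^ n * (1 / real (n + 1)) * (q - 1) ^ Suc n) = (\<lambda>n. - g (Suc n))"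
  proof
    fix n
    have "(q - 1) ^ Suc n = (- 1) ^ Suc n * (1 - q) ^ Suc n"
      by (subst power_mult_distrib[symmetric]) simp
    then have "(- 1) ^ n * (1 / real (n + 1)) * (q - 1) ^ Suc n =
      ((- 1) ^ n * (- 1) ^ Suc n) * ((1 - q) ^ Suc n / real (Suc n))"
      by (simp del: power_Suc)
    also have "(- 1) ^ n * (- 1) ^ Suc n = (- 1 :: real)"
      by (simp flip: power_add mult_2)
    finally show "(- 1) ^ n * (1 / real (n + 1)) * (q - 1) ^ Suc n = - g (Suc n)"
      by (simp add: g_def del: power_Suc)
  qed
  also have "(\<Sum>n. - g (Suc n)) = - (\<Sum>n. g (Suc n))"
    using g by (intro suminf_minus) (simp add: summable_Suc_iff)
  \<comment> \<open>The term \<open>g 0\<close> is \<open>1 / 0 = 0\<close>, so the summation may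
    start at \<open>0\<close>.\<close>
  also have "(\<Sum>n. g (Suc n)) = suminf g"
    using suminf_split_head[OF g] by (simp add: g_def)
  finally have "g sums (- ln q)"
    using g by (simp add: summable_sums)
  from sums_split_initial_segment[OF this, of "Suc m"]
  have "(\<lambda>n. g (n + m + 1)) sums (- ln q - (\<Sum>k<Suc m. g k))"
    by simp
  also have "(\<Sum>k<Suc m. g k) = (\<Sum>k = 1..m. g k)"
    by (intro sum.mono_neutral_right) (auto simp: g_def)
  finally show ?thesis
    unfolding log_tail_def g_def .
qed

lemma log_tail_nonneg: "0 < q \<Longrightarrow> q \<le> 1 \<Longrightarrow> log_tail m q \<ge> 0"
  using sums_le[OF _ sums_zero log_tail_sums[of q m]] by auto

lemma log_tail_le: "0 < q \<Longrightarrow> q \<le> 1 \<Longrightarrow> log_tail m q \<le> - ln q"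
  unfolding log_tail_def by (auto intro!: sum_nonneg)

lemma log_tail_tendsto_0:
  assumes "0 < q" "q \<le> 1"
  shows "(\<lambda>m. log_tail m q) \<longlonglongrightarrow> 0"
proof -
  define g where "g n = (1 - q) ^ Suc n / real (Suc n)" for n
  have "g sums (- ln q)"
    using log_tail_sums[OF assms, of 0] by (simp add: g_def[abs_def] log_tail_def)
  then have "(\<lambda>m. - ln q - (\<Sum>k<m. g k)) \<longlonglongrightarrow> - ln q - (- ln q)"
    unfolding sums_def by (intro tendsto_intros)
  also have "(\<lambda>m. - ln q - (\<Sum>k<m. g k)) = (\<lambda>m. log_tail m q)"
    unfolding log_tail_def g_def
    by (simp add: sum.atLeast1_atMost_eq del: power_Suc of_nat_Suc)
  finally show ?thesis by simp
qed

section \<open>Mean square effect of one observation\<close>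

text \<open>The change \<open>D\<close> caused by one observation, as a function of the number \<open>c\<close> of other occurrences.\<close>

definition plug_in_excess :: "nat \<Rightarrow> real \<Rightarrow> nat \<Rightarrow> real" where
  "plug_in_excess m q c = harm m - harm c + ln q + of_bool (c = 0)"

text \<open>The part \<open>harm m + ln q - harm c\<close> has mean \<open>- log_tail m q\<close>,
  so its second moment is the variance of \<open>harm\<close> plus the squared remainder. The
  indicator of \<open>c = 0\<close> has mean \<open>(1 - q) ^ m\<close>. Separating the two parts
  costs the factors \<open>2\<close>.\<close>

lemma expectation_square_plug_in_excess_le:
  assumes "0 < q" "q \<le> 1"
  shows "measure_pmf.expectation (binomial_pmf m q) (\<lambda>c. (plug_in_excess m q c)\<^sup>2) \<le>
    2 * measure_pmf.expectation (binomial_pmf m q) (\<lambda>c. 1 / real c)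
      + 2 * (log_tail m q)\<^sup>2 + 2 * (1 - q) ^ m"
proof -
  have q: "q \<in> {0..1}" using assms by auto
  let ?E = "measure_pmf.expectation (binomial_pmf m q)"
  let ?h = "harm :: nat \<Rightarrow> real"
  have i [simp]: "integrable (measure_pmf (binomial_pmf m q)) f" for f :: "nat \<Rightarrow> real"
    using q by auto
  have mean: "?E ?h = harm m + ln q + log_tail m q"
    by (simp add: expectation_harm_binomial[OF q] log_tail_def)
  have "?E (\<lambda>c. (plug_in_excess m q c)\<^sup>2) \<le>
    ?E (\<lambda>c. 2 * (harm m + ln q - harm c)\<^sup>2 + 2 * of_bool (c = 0))"
  proof (intro integral_mono)
    fix c
    let ?a = "harm m + ln q - harm c" and ?b = "of_bool (c = 0) :: real"
    have "plug_in_excess m q c = ?a + ?b" by (simp add: plug_in_excess_def)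
    then show "(plug_in_excess m q c)\<^sup>2 \<le> 2 * ?a\<^sup>2 + 2 * ?b"
      using square_add_le[of ?a ?b] by (cases "c = 0") auto
  qed (rule i)+
  also have "\<dots> = 2 * ?E (\<lambda>c. (harm m + ln q - harm c)\<^sup>2) + 2 * ?E (\<lambda>c. of_bool (c = 0))"
    by simp
  also have "?E (\<lambda>c. of_bool (c = 0)) = (1 - q) ^ m"
  proof -
    have "?E (\<lambda>c. of_bool (c = 0)) = ?E (indicator {0})"
      by (intro arg_cong[where f = ?E]) (auto simp: fun_eq_iff)
    also have "\<dots> = measure (binomial_pmf m q) {0}"
      by (subst Bochner_Integration.integral_indicator) auto
    also have "\<dots> = (1 - q) ^ m"
      using q by (simp add: measure_pmf_single)
    finally show ?thesis .
  qed
  also have "?E (\<lambda>c. (harm m + ln q - harm c)\<^sup>2) =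
    measure_pmf.variance (binomial_pmf m q) ?h + (log_tail m q)\<^sup>2"
  proof -
    have "?E (\<lambda>c. (harm m + ln q - harm c)\<^sup>2) =
      ?E (\<lambda>c. (harm c - ?E ?h)\<^sup>2 + 2 * log_tail m q * (harm c - ?E ?h) + (log_tail m q)\<^sup>2)"
      by (intro arg_cong[where f = ?E] ext) (simp add: mean power2_eq_square algebra_simps)
    also have "\<dots> = measure_pmf.variance (binomial_pmf m q) ?h + (log_tail m q)\<^sup>2"
      by simp
    finally show ?thesis .
  qed
  finally show ?thesis
    using mult_left_mono[OF variance_harm_binomial_le[OF q, of m], of 2] by (simp add: distrib_left)
qed

text \<open>A bound uniform in \<open>m\<close>, to serve as the dominating function when
  \<open>q = pmf p y\<close> is averaged over \<open>y\<close>.\<close>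

lemma expectation_square_plug_in_excess_le_ln:
  assumes "0 < q" "q \<le> 1"
  shows "measure_pmf.expectation (binomial_pmf m q) (\<lambda>c. (plug_in_excess m q c)\<^sup>2) \<le> 4 + 2 * (ln q)\<^sup>2"
proof -
  have q: "q \<in> {0..1}" using assms by auto
  have "measure_pmf.expectation (binomial_pmf m q) (\<lambda>c. 1 / real c) \<le>
    measure_pmf.expectation (binomial_pmf m q) (\<lambda>c. 1)"
    by (intro integral_mono) (use q in \<open>auto simp: divide_simps\<close>)
  moreover have "(log_tail m q)\<^sup>2 \<le> (ln q)\<^sup>2"
    using power_mono[OF log_tail_le[OF assms] log_tail_nonneg[OF assms], of m 2] by simp
  moreover have "(1 - q) ^ m \<le> 1" using assms by (simp add: power_le_one)
  ultimately show ?thesis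
    using expectation_square_plug_in_excess_le[OF assms, of m] by simp
qed

text \<open>Each of the three bounds tends to zero for fixed \<open>q > 0\<close>: the mean of
  \<open>1 / c\<close> is of order \<open>1 / (q * m)\<close>, and the other two are a series
  remainder and a geometric sequence.\<close>

lemma expectation_square_plug_in_excess_tendsto_0:
  assumes "0 < q" "q \<le> 1"
  shows "(\<lambda>m. measure_pmf.expectation (binomial_pmf m q) (\<lambda>c. (plug_in_excess m q c)\<^sup>2)) \<longlonglongrightarrow> 0"
proof (rule tendsto_sandwich[where f = "\<lambda>_. 0"])
  have q: "q \<in> {0..1}" using assms by auto
  let ?ub = "\<lambda>m. 2 * (2 / (q * real (Suc m))) + 2 * (log_tail m q)\<^sup>2 + 2 * (1 - q) ^ m"
  show "\<forall>\<^sub>F m in sequentially.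
    measure_pmf.expectation (binomial_pmf m q) (\<lambda>c. (plug_in_excess m q c)\<^sup>2) \<le> ?ub m"
  proof (intro always_eventually allI)
    fix m
    have "measure_pmf.expectation (binomial_pmf m q) (\<lambda>c. 1 / real c) \<le> 2 / (q * real (Suc m))"
      using expectation_inverse_binomial_le[OF q, of m] assms
      by (simp add: field_simps del: of_nat_Suc)
    then show "measure_pmf.expectation (binomial_pmf m q) (\<lambda>c. (plug_in_excess m q c)\<^sup>2) \<le> ?ub m"
      using expectation_square_plug_in_excess_le[OF assms, of m] by linarith
  qed
  have "(\<lambda>m. 2 / (q * real (Suc m))) \<longlonglongrightarrow> 0"
    using tendsto_mult_right_zero[OF LIMSEQ_inverse_real_of_nat, of "2 / q"]
    by (simp add: divide_inverse mult_ac)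
  moreover have "(\<lambda>m. (1 - q) ^ m) \<longlonglongrightarrow> 0"
    using assms by (intro LIMSEQ_power_zero) auto
  ultimately have "?ub \<longlonglongrightarrow> 2 * 0 + 2 * 0\<^sup>2 + 2 * 0"
    by (intro tendsto_add tendsto_mult tendsto_const tendsto_power log_tail_tendsto_0 assms)
  then show "?ub \<longlonglongrightarrow> 0" by simp
qed simp_all


section \<open>Consequences of the tail condition\<close>

text \<open>Bounding the logarithm by a small negative power of \<open>q\<close> gives
  \<open>q * (ln q)\<^sup>2 \<le> 64 * q powr (3 / 4)\<close>, which is eventually at most
  \<open>64 * j powr (- 3 / 2)\<close>, a summable sequence.\<close>

lemma integrable_square_ln_pmf:
  fixes p :: "nat pmf"
  assumes "(\<lambda>j. pmf p j) \<in> o[at_top](\<lambda>j. 1 / real j ^ 2)"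
  shows "integrable (measure_pmf p) (\<lambda>x. (ln (pmf p x))\<^sup>2)"
proof -
  have "summable (\<lambda>j. pmf p j * (ln (pmf p j))\<^sup>2)"
  proof (rule summable_comparison_test_ev)
    have "summable (\<lambda>j. real j powr (- 3 / 2))"
      by (subst summable_real_powr_iff) auto
    then show "summable (\<lambda>j. 64 * real j powr (- 3 / 2))" by (rule summable_mult)
    have "eventually (\<lambda>j. norm (pmf p j) \<le> 1 * norm (1 / real j ^ 2)) at_top"
      using assms by (rule landau_o.smallD) simp
    then show "eventually (\<lambda>j. norm (pmf p j * (ln (pmf p j))\<^sup>2) \<le> 64 * real j powr (- 3 / 2)) at_top"
      using eventually_ge_at_top[of 1]
    proof eventually_elim
      case (elim j)
      define q where "q = pmf p j"
      have q: "0 \<le> q" "q \<le> 1" "q \<le> 1 / real j ^ 2" using elim by (auto simp: q_def pmf_le_1)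
      show ?case
      proof (cases "q = 0")
        case False
        then have q0: "q > 0" using q by simp
        \<comment> \<open>Any exponent below \<open>1 / 4\<close> works: squaring doubles it, and
          the remaining power of \<open>q\<close>, at most a power of \<open>1 / j\<^sup>2\<close>,
          must stay above \<open>1 / 2\<close>.\<close>
        have "ln (1 / q) \<le> (1 / q) powr (1 / 8) / (1 / 8)"
          by (rule ln_powr_bound) (use q q0 in auto)
        then have "- ln q \<le> 8 * q powr (- 1 / 8)"
          using q0 by (simp add: ln_div powr_divide powr_minus_divide)
        then have "(- ln q)\<^sup>2 \<le> (8 * q powr (- 1 / 8))\<^sup>2"
          using q q0 by (intro power_mono) auto
        also have "\<dots> = 64 * q powr (- 1 / 4)"
          by (simp add: power_mult_distrib power2_eq_square flip: powr_add)
        finally have "q * (ln q)\<^sup>2 \<le> q * (64 * q powr (- 1 / 4))"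
          using q by (intro mult_left_mono) auto
        also have "\<dots> = 64 * q powr (3 / 4)"
          using q0 powr_add[of q 1 "- 1 / 4"] by simp
        also have "\<dots> \<le> 64 * (1 / real j ^ 2) powr (3 / 4)"
          using q by (intro mult_left_mono powr_mono2) auto
        also have "1 / real j ^ 2 = real j powr (- 2)"
          using elim by (simp add: powr_minus_divide powr_numeral)
        also have "(real j powr (- 2)) powr (3 / 4) = real j powr (- 3 / 2)"
          by (simp add: powr_powr)
        finally show ?thesis using q by (simp add: q_def)
      qed (simp add: q_def)
    qed
  qed
  then have "integrable (count_space UNIV) (\<lambda>j. pmf p j * (ln (pmf p j))\<^sup>2)"
    by (simp add: integrable_count_space_nat_iff)
  then show ?thesis
    by (subst measure_pmf_eq_density, subst integrable_density) auto
qed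

section \<open>Decay of the mean remainder\<close>

text \<open>\<open>(1 - q) ^ k\<close> is the smallest of the \<open>k + 1\<close> terms of a
  geometric sum, and \<open>q\<close> times that sum is at most \<open>1\<close>.\<close>

lemma mult_power_one_minus_le:
  fixes q :: real
  assumes "0 \<le> q" "q \<le> 1"
  shows "q * (1 - q) ^ k \<le> 1 / real (Suc k)"
proof -
  have "real (Suc k) * (1 - q) ^ k = (\<Sum>i\<le>k. (1 - q) ^ k)" by simp
  also have "\<dots> \<le> (\<Sum>i\<le>k. (1 - q) ^ i)"
    using assms by (intro sum_mono power_decreasing) auto
  finally have "q * (real (Suc k) * (1 - q) ^ k) \<le> q * (\<Sum>i\<le>k. (1 - q) ^ i)"
    using assms by (intro mult_left_mono)
  also have "\<dots> = 1 - (1 - q) ^ Suc k"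
    using one_diff_power_eq[of "1 - q" "Suc k"] by (simp add: lessThan_Suc_atMost)
  also have "\<dots> \<le> 1" using assms by simp
  finally show ?thesis by (simp add: field_simps)
qed

text \<open>Comparison with a telescoping series:
  \<open>1 / j\<^sup>2 \<le> 1 / (j - 1) - 1 / j\<close>.\<close>

lemma prob_greaterThan_le_of_pmf_le:
  fixes p :: "nat pmf"
  assumes c: "c \<ge> 0" and le: "\<And>j. j > N \<Longrightarrow> pmf p j \<le> c / (real j)\<^sup>2" and N: "N > 0"
  shows "measure_pmf.prob p {N<..} \<le> c / real N"
proof -
  have "(\<lambda>i. measure_pmf.prob p {Suc (N + i)}) sums measure_pmf.prob p (\<Union>i. {Suc (N + i)})"
    by (intro measure_pmf.finite_measure_UNION) (auto simp: disjoint_family_on_def)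
  moreover have "(\<Union>i. {Suc (N + i)}) = {N<..}"
    by (auto simp: set_eq_iff) (metis less_iff_Suc_add)
  ultimately have 1: "(\<lambda>i. pmf p (Suc (N + i))) sums measure_pmf.prob p {N<..}"
    by (simp add: measure_pmf_single)
  have "(\<lambda>i. c / real (N + i)) \<longlonglongrightarrow> 0"
    using LIMSEQ_ignore_initial_segment[OF lim_const_over_n[of c], of N] by (simp add: add.commute)
  from telescope_sums'[OF this]
  have 2: "(\<lambda>i. c / real (N + i) - c / real (N + Suc i)) sums (c / real N)" by simp
  show ?thesis
  proof (rule sums_le[OF _ 1 2])
    fix i
    let ?r = "real (N + i)"
    have r: "?r > 0" using N by simp
    have "pmf p (Suc (N + i)) \<le> c / (?r + 1)\<^sup>2" using le[of "Suc (N + i)"] by (simp add: add_ac)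
    also have "\<dots> \<le> c / (?r * (?r + 1))"
      using r c by (intro divide_left_mono) (auto simp: power2_eq_square)
    also have "\<dots> = c / ?r - c / (?r + 1)" using r by (simp add: field_simps)
    finally show "pmf p (Suc (N + i)) \<le> c / real (N + i) - c / real (N + Suc i)" by (simp add: add_ac)
  qed
qed

text \<open>Each of the \<open>N + 1\<close> symbols up to \<open>N\<close> contributes at most
  \<open>1 / (k + 1)\<close>, by \<open>mult_power_one_minus_le\<close>; beyond \<open>N\<close> the
  power is bounded by \<open>1\<close>.\<close>

lemma expectation_power_one_minus_pmf_le:
  fixes p :: "nat pmf"
  shows "measure_pmf.expectation p (\<lambda>x. (1 - pmf p x) ^ k) \<le>
    real (Suc N) / real (Suc k) + measure_pmf.prob p {N<..}"
proof -
  let ?E = "measure_pmf.expectation p"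
  have i: "integrable (measure_pmf p) f" if "\<And>x. \<bar>f x\<bar> \<le> 1" for f :: "nat \<Rightarrow> real"
    by (rule measure_pmf.integrable_const_bound[where B = 1]) (use that in auto)
  have "?E (\<lambda>x. (1 - pmf p x) ^ k) \<le>
    ?E (\<lambda>x. (\<Sum>j\<le>N. (1 - pmf p j) ^ k * indicator {j} x) + indicator {N<..} x)"
  proof (rule integral_mono)
    show "(1 - pmf p x) ^ k \<le> (\<Sum>j\<le>N. (1 - pmf p j) ^ k * indicator {j} x) + indicator {N<..} x" for x
    proof (cases "x \<le> N")
      case True
      then have "(\<Sum>j\<le>N. (1 - pmf p j) ^ k * indicator {j} x) = (\<Sum>j\<in>{x}. (1 - pmf p j) ^ k)"
        by (intro sum.mono_neutral_cong_right) (auto simp: indicator_def)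
      then show ?thesis by simp
    next
      case False
      have "(\<Sum>j\<le>N. (1 - pmf p j) ^ k * indicator {j} x) \<ge> 0"
        by (intro sum_nonneg) (auto simp: pmf_le_1)
      moreover have "(1 - pmf p x) ^ k \<le> 1" by (simp add: power_le_one pmf_le_1)
      ultimately show ?thesis using False by simp
    qed
    show "integrable (measure_pmf p) (\<lambda>x. (1 - pmf p x) ^ k)"
      by (rule i) (simp add: power_le_one pmf_le_1)
    show "integrable (measure_pmf p)
      (\<lambda>x. (\<Sum>j\<le>N. (1 - pmf p j) ^ k * indicator {j} x) + indicator {N<..} x)"
      by (intro Bochner_Integration.integrable_add Bochner_Integration.integrable_sum integrable_mult_right i)
         (auto simp: indicator_def)
  qed
  also have "\<dots> = (\<Sum>j\<le>N. (1 - pmf p j) ^ k * pmf p j) + measure_pmf.prob p {N<..}"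
  proof -
    have ind: "integrable (measure_pmf p) (indicator A :: nat \<Rightarrow> real)" for A
      by (rule i) (auto simp: indicator_def)
    have "?E (\<lambda>x. (\<Sum>j\<le>N. (1 - pmf p j) ^ k * indicator {j} x) + indicator {N<..} x) =
      ?E (\<lambda>x. \<Sum>j\<le>N. (1 - pmf p j) ^ k * indicator {j} x) + ?E (indicator {N<..})"
      by (intro Bochner_Integration.integral_add Bochner_Integration.integrable_sum integrable_mult_right ind)
    also have "?E (\<lambda>x. \<Sum>j\<le>N. (1 - pmf p j) ^ k * indicator {j} x) =
      (\<Sum>j\<le>N. ?E (\<lambda>x. (1 - pmf p j) ^ k * indicator {j} x))"
      by (intro Bochner_Integration.integral_sum integrable_mult_right ind)
    also have "\<dots> = (\<Sum>j\<le>N. (1 - pmf p j) ^ k * pmf p j)"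
      by (intro sum.cong refl, subst integral_mult_right_zero, subst Bochner_Integration.integral_indicator)
         (simp add: measure_pmf_single)
    also have "?E (indicator {N<..}) = measure_pmf.prob p {N<..}"
      by (subst Bochner_Integration.integral_indicator) simp
    finally show ?thesis .
  qed
  also have "(\<Sum>j\<le>N. (1 - pmf p j) ^ k * pmf p j) \<le> (\<Sum>j\<le>N. 1 / real (Suc k))"
    using mult_power_one_minus_le[of "pmf p _" k] by (intro sum_mono) (simp add: mult.commute pmf_le_1)
  finally show ?thesis by simp
qed

text \<open>Cut at \<open>N\<close> of order \<open>d * sqrt k\<close>. The symbols up to
  \<open>N\<close> contribute order \<open>N / k\<close>; since eventually
  \<open>pmf p j \<le> d\<^sup>2 / j\<^sup>2\<close>, the others contribute at most
  \<open>d\<^sup>2 / N\<close>. Both are of order \<open>d / sqrt k\<close>, with \<open>d\<close>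
  as small as desired.\<close>

lemma expectation_power_one_minus_pmf_eventually_le:
  fixes p :: "nat pmf"
  assumes o: "(\<lambda>j. pmf p j) \<in> o[at_top](\<lambda>j. 1 / real j ^ 2)" and e: "e > 0"
  shows "eventually (\<lambda>k. measure_pmf.expectation p (\<lambda>x. (1 - pmf p x) ^ k) \<le> e / sqrt (real k)) at_top"
proof -
  \<comment> \<open>The symbols up to \<open>N\<close> will cost \<open>3 * d / s\<close> and the
    tail \<open>d / s\<close>, where \<open>s\<close> is \<open>sqrt k\<close>.\<close>
  define d where "d = e / 4"
  have d: "d > 0" using e by (simp add: d_def)
  have "eventually (\<lambda>j. norm (pmf p j) \<le> d\<^sup>2 * norm (1 / real j ^ 2)) at_top"
    using o by (rule landau_o.smallD) (use d in simp)
  then obtain j0 where j0: "\<And>j. j \<ge> j0 \<Longrightarrow> pmf p j \<le> d\<^sup>2 / (real j)\<^sup>2"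
    by (auto simp: eventually_at_top_linorder)
  have s: "filterlim (\<lambda>k. sqrt (real k)) at_top sequentially"
    by (rule filterlim_compose[OF sqrt_at_top filterlim_real_sequentially])
  have "eventually (\<lambda>k. sqrt (real k) \<ge> real j0 / d) sequentially"
    using s by (auto simp: filterlim_at_top)
  moreover have "eventually (\<lambda>k. sqrt (real k) \<ge> 1 / d) sequentially"
    using s by (auto simp: filterlim_at_top)
  ultimately show ?thesis
    using eventually_gt_at_top[of 0]
  proof eventually_elim
    case (elim k)
    define s where "s = sqrt (real k)"
    have s: "s > 0" "s * s = real k" using elim by (auto simp: s_def)
    define N where "N = nat \<lceil>d * s\<rceil>"
    have N: "d * s \<le> real N" "real N \<le> d * s + 1" "N > 0"
      using d s elim(3) unfolding N_def by (auto simp: of_nat_nat ceiling_le_iff intro!: less_imp_le)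
    have "real j0 \<le> d * s" using elim(1) d by (simp add: s_def field_simps)
    then have jN: "j0 \<le> N" using N by simp
    have ds: "1 \<le> d * s" using elim(2) d by (simp add: s_def field_simps)
    have "measure_pmf.prob p {N<..} \<le> d\<^sup>2 / real N"
      by (rule prob_greaterThan_le_of_pmf_le) (use j0 jN N in auto)
    also have "\<dots> \<le> d\<^sup>2 / (d * s)"
      using N d s by (intro divide_left_mono) auto
    also have "\<dots> = d / s" using d by (simp add: power2_eq_square)
    finally have 1: "measure_pmf.prob p {N<..} \<le> d / s" .
    \<comment> \<open>\<open>N + 1 \<le> d * s + 2 \<le> 3 * (d * s)\<close>, the last step because
      \<open>1 \<le> d * s\<close>.\<close>
    have "real (Suc N) / real (Suc k) \<le> (3 * (d * s)) / (s * s)"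
      using N ds s elim(3) by (intro frac_le) auto
    also have "\<dots> = 3 * d / s" using s(1) by simp
    finally have "measure_pmf.expectation p (\<lambda>x. (1 - pmf p x) ^ k) \<le> 3 * d / s + d / s"
      using 1 expectation_power_one_minus_pmf_le[of p k N] by linarith
    also have "\<dots> = e / s" by (simp add: d_def add_divide_distrib[symmetric])
    finally show ?case by (simp add: s_def)
  qed
qed

text \<open>With \<open>a = sqrt m\<close> and \<open>b = sqrt (m + 1)\<close> one has
  \<open>1 = (b - a) * (b + a)\<close>. Enlarging \<open>b + a\<close> to \<open>2 * b\<close> and
  shrinking one factor \<open>b\<close> of the denominator to \<open>a\<close> gives the
  difference.\<close>

lemma inverse_mult_sqrt_le_telescope:
  assumes "m > 0"
  shows "1 / (real (Suc m) * sqrt (real (Suc m))) \<le> 2 / sqrt (real m) - 2 / sqrt (real (Suc m))"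
proof -
  define a b where "a = sqrt (real m)" and "b = sqrt (real (Suc m))"
  have ab: "0 < a" "a \<le> b" "0 < b" using assms by (auto simp: a_def b_def)
  have "b * b - a * a = 1" "b * b = real (Suc m)" by (auto simp: a_def b_def)
  then have "(b - a) * (b + a) = 1" by (simp add: algebra_simps)
  then have "1 / (b * b * b) = (b - a) * (b + a) / (b * b * b)" by simp
  also have "\<dots> \<le> (b - a) * (2 * b) / (a * b * b)"
    using ab by (intro frac_le mult_left_mono mult_right_mono) auto
  also have "\<dots> = 2 / a - 2 / b" using ab by (simp add: field_simps)
  finally show ?thesis using \<open>b * b = real (Suc m)\<close> by (simp add: a_def b_def)
qed

text \<open>The \<open>k\<close>-th term of the remainder has mean at most
  \<open>d / (k * sqrt k)\<close> for large \<open>k\<close>, and summing over \<open>k > m\<close>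
  by telescoping leaves \<open>2 * d / sqrt m\<close>.\<close>

lemma expectation_log_tail_tendsto_0:
  fixes p :: "nat pmf"
  assumes o: "(\<lambda>j. pmf p j) \<in> o[at_top](\<lambda>j. 1 / real j ^ 2)"
  shows "(\<lambda>m. sqrt (real m) * measure_pmf.expectation p (\<lambda>x. log_tail m (pmf p x))) \<longlonglongrightarrow> 0"
proof (rule LIMSEQ_I)
  fix e :: real assume "e > 0"
  \<comment> \<open>The final bound is \<open>2 * d\<close>, strictly below
    \<open>e\<close>.\<close>
  define d where "d = e / 3"
  have d: "d > 0" using \<open>e > 0\<close> by (simp add: d_def)
  obtain K where K: "\<And>k. k \<ge> K \<Longrightarrow> measure_pmf.expectation p (\<lambda>x. (1 - pmf p x) ^ k) \<le> d / sqrt (real k)"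
    using expectation_power_one_minus_pmf_eventually_le[OF o d] by (auto simp: eventually_at_top_linorder)
  have "norm (sqrt (real m) * measure_pmf.expectation p (\<lambda>x. log_tail m (pmf p x)) - 0) < e"
    if m: "m \<ge> Suc K" for m
  proof -
    have nonneg: "AE x in measure_pmf p. 0 \<le> log_tail m (pmf p x)"
      by (auto simp: AE_measure_pmf_iff pmf_le_1 pmf_positive intro!: log_tail_nonneg)
    \<comment> \<open>The terms are nonnegative, so in \<open>ennreal\<close> the series and the
      expectation can be exchanged.\<close>
    have "(\<integral>\<^sup>+x. ennreal (log_tail m (pmf p x)) \<partial>measure_pmf p) =
      (\<integral>\<^sup>+x. (\<Sum>i. ennreal ((1 - pmf p x) ^ (i + m + 1) / real (i + m + 1))) \<partial>measure_pmf p)"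
    proof (intro nn_integral_cong_AE AE_pmfI)
      fix x assume "x \<in> set_pmf p"
      then show "ennreal (log_tail m (pmf p x)) =
        (\<Sum>i. ennreal ((1 - pmf p x) ^ (i + m + 1) / real (i + m + 1)))"
        by (intro suminf_ennreal_eq[symmetric] log_tail_sums) (auto simp: pmf_le_1 pmf_positive)
    qed
    also have "\<dots> = (\<Sum>i. \<integral>\<^sup>+x. ennreal ((1 - pmf p x) ^ (i + m + 1) / real (i + m + 1)) \<partial>measure_pmf p)"
      by (rule nn_integral_suminf) simp
    also have "\<dots> \<le> (\<Sum>i. ennreal (2 * d / sqrt (real (m + i)) - 2 * d / sqrt (real (m + Suc i))))"
    proof (intro suminf_le allI)
      fix i
      let ?k = "i + m + 1"
      have "(\<integral>\<^sup>+x. ennreal ((1 - pmf p x) ^ ?k / real ?k) \<partial>measure_pmf p) =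
        ennreal (measure_pmf.expectation p (\<lambda>x. (1 - pmf p x) ^ ?k / real ?k))"
      proof (intro nn_integral_eq_integral)
        show "integrable (measure_pmf p) (\<lambda>x. (1 - pmf p x) ^ ?k / real ?k)"
          by (intro integrable_divide measure_pmf.integrable_const_bound[where B = 1])
             (auto simp: power_le_one pmf_le_1 simp del: power_Suc)
      qed (auto simp: pmf_le_1 simp del: power_Suc)
      also have "measure_pmf.expectation p (\<lambda>x. (1 - pmf p x) ^ ?k / real ?k) =
        measure_pmf.expectation p (\<lambda>x. (1 - pmf p x) ^ ?k) / real ?k"
        by (rule integral_divide_zero)
      also have "\<dots> \<le> (d / sqrt (real ?k)) / real ?k"
        by (intro divide_right_mono K) (use m in auto)
      also have "\<dots> = d * (1 / (real (Suc (m + i)) * sqrt (real (Suc (m + i)))))"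
        by (simp add: field_simps)
      also have "\<dots> \<le> d * (2 / sqrt (real (m + i)) - 2 / sqrt (real (Suc (m + i))))"
        using d m by (intro mult_left_mono inverse_mult_sqrt_le_telescope) auto
      also have "\<dots> = 2 * d / sqrt (real (m + i)) - 2 * d / sqrt (real (m + Suc i))"
        by (simp add: algebra_simps)
      finally show "(\<integral>\<^sup>+x. ennreal ((1 - pmf p x) ^ ?k / real ?k) \<partial>measure_pmf p) \<le>
        ennreal (2 * d / sqrt (real (m + i)) - 2 * d / sqrt (real (m + Suc i)))"
        by (simp add: ennreal_leI)
    qed auto
    also have "\<dots> = ennreal (2 * d / sqrt (real m))"
    proof (rule suminf_ennreal_eq)
      show "0 \<le> 2 * d / sqrt (real (m + i)) - 2 * d / sqrt (real (m + Suc i))" for i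
        using m d by (auto intro!: divide_left_mono)
      have s: "filterlim (\<lambda>k. sqrt (real k)) at_top sequentially"
        by (rule filterlim_compose[OF sqrt_at_top filterlim_real_sequentially])
      have "(\<lambda>i. 2 * d / sqrt (real i)) \<longlonglongrightarrow> 0"
        by (rule real_tendsto_divide_at_top[OF tendsto_const s])
      from LIMSEQ_ignore_initial_segment[OF this, of m]
      have "(\<lambda>i. 2 * d / sqrt (real (m + i))) \<longlonglongrightarrow> 0"
        by (simp add: add.commute)
      from telescope_sums'[OF this]
      show "(\<lambda>i. 2 * d / sqrt (real (m + i)) - 2 * d / sqrt (real (m + Suc i))) sums (2 * d / sqrt (real m))"
        by simp
    qed
    finally have "measure_pmf.expectation p (\<lambda>x. log_tail m (pmf p x)) \<le> 2 * d / sqrt (real m)"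
      using nonneg d by (subst integral_eq_nn_integral) (auto intro!: enn2real_leI)
    then have "sqrt (real m) * measure_pmf.expectation p (\<lambda>x. log_tail m (pmf p x)) \<le> 2 * d"
      using m by (simp add: field_simps)
    also have "\<dots> < e" using \<open>e > 0\<close> by (simp add: d_def)
    finally show ?thesis
      using integral_nonneg_AE[OF nonneg] by simp
  qed
  then show "\<exists>no. \<forall>m\<ge>no. norm (sqrt (real m) * measure_pmf.expectation p (\<lambda>x. log_tail m (pmf p x)) - 0) < e"
    by blast
qed


section \<open>Second moment of the plug-in excess\<close>

text \<open>The new observation contributes \<open>harm c\<close>. Each of the \<open>c\<close>
  earlier observations equal to it gains \<open>harm c - harm (c - 1) = 1 / c\<close>, a total of
  \<open>1\<close> unless \<open>c = 0\<close>.\<close>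

lemma sum_harm_multiplicity_insert:
  fixes x :: "'i \<Rightarrow> 'b"
  assumes A: "finite A" "i \<notin> A"
  defines "c \<equiv> card {l\<in>A. x l = x i}"
  shows "(\<Sum>k\<in>insert i A. harm (card {l\<in>insert i A. x l = x k} - 1)) =
    (\<Sum>k\<in>A. harm (card {l\<in>A. x l = x k} - 1)) + (harm c + of_bool (c \<noteq> 0) :: real)"
proof -
  have eq: "{l\<in>insert i A. x l = x k} = (if x k = x i then insert i {l\<in>A. x l = x i} else {l\<in>A. x l = x k})" for k
    by auto
  have ci: "card (insert i {l\<in>A. x l = x i}) = Suc c"
    using A by (simp add: c_def)
  have ci': "card {l\<in>insert i A. x l = x i} = Suc c"
    by (simp only: eq[of i] ci refl if_True)
  then have "(\<Sum>k\<in>insert i A. harm (card {l\<in>insert i A. x l = x k} - 1)) =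
    harm c + (\<Sum>k\<in>A. harm (card {l\<in>insert i A. x l = x k} - 1) :: real)"
    using A by (simp del: insert_iff)
  also have "(\<Sum>k\<in>A. harm (card {l\<in>insert i A. x l = x k} - 1)) =
    (\<Sum>k\<in>A. harm (card {l\<in>A. x l = x k} - 1) + (if x k = x i then 1 / real c else 0 :: real))"
  proof (intro sum.cong refl)
    fix k assume k: "k \<in> A"
    show "harm (card {l\<in>insert i A. x l = x k} - 1) =
      harm (card {l\<in>A. x l = x k} - 1) + (if x k = x i then 1 / real c else 0 :: real)"
    proof (cases "x k = x i")
      case True
      then have "c \<noteq> 0" using k A by (auto simp: c_def)
      then obtain c' where "c = Suc c'" by (cases c) auto
      moreover have "card {l\<in>A. x l = x k} = c" using True by (simp add: c_def)
      ultimately show ?thesis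
        using True unfolding True ci' by (simp add: harm_Suc inverse_eq_divide)
    next
      case False
      then show ?thesis unfolding eq[of k] by simp
    qed
  qed
  also have "\<dots> = (\<Sum>k\<in>A. harm (card {l\<in>A. x l = x k} - 1)) + (\<Sum>k | k \<in> A \<and> x k = x i. 1 / real c)"
    by (simp only: sum.distrib sum.inter_filter[OF A(1)])
  also have "(\<Sum>k | k \<in> A \<and> x k = x i. 1 / real c) = of_bool (c \<noteq> 0)"
    by (simp add: c_def)
  finally show ?thesis by simp
qed

text \<open>The quantity \<open>F\<close> for the sample indexed by \<open>A\<close>.\<close>

definition plug_in_excess_sum :: "'b pmf \<Rightarrow> 'i set \<Rightarrow> ('i \<Rightarrow> 'b) \<Rightarrow> real" where
  "plug_in_excess_sum p A x =
    (\<Sum>k\<in>A. harm (card A - 1) - harm (card {l\<in>A. x l = x k} - 1) + ln (pmf p (x k)))"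

text \<open>Only the last summand involves \<open>x i\<close>, so it is the whole effect of this
  observation. The constant \<open>- 1\<close> and the indicator inside
  \<open>plug_in_excess\<close> come from rewriting \<open>of_bool (c \<noteq> 0)\<close> as
  \<open>1 - of_bool (c = 0)\<close>.\<close>

lemma plug_in_excess_sum_insert:
  assumes "finite A" "i \<notin> A"
  shows "plug_in_excess_sum p (insert i A) x =
    real (card A) * harm (card A) - 1 - (\<Sum>k\<in>A. harm (card {l\<in>A. x l = x k} - 1))
      + (\<Sum>k\<in>A. ln (pmf p (x k)))
      + plug_in_excess (card A) (pmf p (x i)) (card {l\<in>A. x l = x i})"
proof -
  have "plug_in_excess_sum p (insert i A) x =
    real (Suc (card A)) * harm (card A)
      - (\<Sum>k\<in>insert i A. harm (card {l\<in>insert i A. x l = x k} - 1))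
      + (\<Sum>k\<in>insert i A. ln (pmf p (x k)))"
    using assms by (simp only: plug_in_excess_sum_def sum.distrib sum_subtractf) simp
  moreover define c where "c = card {l\<in>A. x l = x i}"
  moreover have "(of_bool (c \<noteq> 0) :: real) = 1 - of_bool (c = 0)" by simp
  ultimately show ?thesis
    unfolding sum_harm_multiplicity_insert[OF assms] c_def[symmetric]
    using assms by (simp only: plug_in_excess_def sum.insert of_nat_Suc) (simp add: algebra_simps)
qed

text \<open>Conditionally on \<open>x i = y\<close>, the number of other observations equal to
  \<open>y\<close> is binomial.\<close>

lemma expectation_multiplicity_Pi_pmf:
  fixes h :: "'b \<Rightarrow> nat \<Rightarrow> real"
  assumes A: "finite A" "i \<notin> A"
    and int: "integrable (measure_pmf (Pi_pmf (insert i A) d (\<lambda>_. p)))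
      (\<lambda>x. h (x i) (card {l\<in>A. x l = x i}))"
  shows "measure_pmf.expectation (Pi_pmf (insert i A) d (\<lambda>_. p)) (\<lambda>x. h (x i) (card {l\<in>A. x l = x i})) =
    measure_pmf.expectation p (\<lambda>y. measure_pmf.expectation (binomial_pmf (card A) (pmf p y)) (h y))"
proof -
  let ?Q = "Pi_pmf A d (\<lambda>_. p)"
  have upd: "h ((x(i := y)) i) (card {l\<in>A. (x(i := y)) l = (x(i := y)) i}) = h y (card {l\<in>A. x l = y})"
    for x y
  proof -
    have "{l\<in>A. (x(i := y)) l = (x(i := y)) i} = {l\<in>A. x l = y}"
      using A by auto
    then show ?thesis by (simp only: fun_upd_same)
  qed
  have P: "Pi_pmf (insert i A) d (\<lambda>_. p) = map_pmf (\<lambda>(y, x). x(i := y)) (pair_pmf p ?Q)"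
    by (rule Pi_pmf_insert[OF A])
  have "integrable (measure_pmf (pair_pmf p ?Q)) (\<lambda>(y, x). h y (card {l\<in>A. x l = y}))"
    using int unfolding P by (simp add: case_prod_unfold upd del: fun_upd_apply)
  from integral_pair_pmf[OF this]
  have "measure_pmf.expectation (Pi_pmf (insert i A) d (\<lambda>_. p)) (\<lambda>x. h (x i) (card {l\<in>A. x l = x i})) =
    measure_pmf.expectation p (\<lambda>y. measure_pmf.expectation ?Q (\<lambda>x. h y (card {l\<in>A. x l = y})))"
    unfolding P by (simp add: case_prod_unfold upd del: fun_upd_apply)
  then show ?thesis
    using A by (simp add: map_pmf_card_eq_Pi_pmf[OF A(1), of _ d p, symmetric])
qed

section \<open>Mean and variance under the product law\<close>

context
  fixes p :: "nat pmf"
  assumes o: "(\<lambda>j. pmf p j) \<in> o[at_top](\<lambda>j. 1 / real j ^ 2)"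
begin

lemma square_integrable_ln_pmf_component:
  assumes "finite A" "k \<in> A"
  shows "integrable (measure_pmf (Pi_pmf A d (\<lambda>_. p))) (\<lambda>x. (ln (pmf p (x k)))\<^sup>2)"
proof -
  have "map_pmf (\<lambda>x. x k) (Pi_pmf A d (\<lambda>_. p)) = p"
    using assms by (simp add: Pi_pmf_component)
  then have "integrable (measure_pmf (map_pmf (\<lambda>x. x k) (Pi_pmf A d (\<lambda>_. p)))) (\<lambda>y. (ln (pmf p y))\<^sup>2)"
    using integrable_square_ln_pmf[OF o] by simp
  then show ?thesis by simp
qed

text \<open>A multiplicity is at most \<open>card A\<close>, so the function is bounded.\<close>

lemma square_integrable_multiplicity:
  fixes f :: "nat \<Rightarrow> real"
  assumes "finite A"
  shows "integrable (measure_pmf P) (\<lambda>x. (f (card {l\<in>A. x l = y x}))\<^sup>2)"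
proof (rule measure_pmf.integrable_const_bound[where B = "Max ((\<lambda>c. (f c)\<^sup>2) ` {..card A})"])
  show "AE x in measure_pmf P. norm ((f (card {l\<in>A. x l = y x}))\<^sup>2) \<le> Max ((\<lambda>c. (f c)\<^sup>2) ` {..card A})"
    using assms by (intro AE_pmfI) (auto intro!: Max_ge imageI card_mono)
qed simp

lemma square_integrable_plug_in_excess_sum:
  assumes "finite A"
  shows "integrable (measure_pmf (Pi_pmf A d (\<lambda>_. p))) (\<lambda>x. (plug_in_excess_sum p A x)\<^sup>2)"
  unfolding plug_in_excess_sum_def
  by (intro square_integrable_sum square_integrable_add
        square_integrable_multiplicity[OF assms, where f = "\<lambda>c. harm (card A - 1) - harm (c - 1)"]
        square_integrable_ln_pmf_component assms) auto

lemma variance_plug_in_excess_sum_le: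
  assumes A: "finite A"
  shows "measure_pmf.variance (Pi_pmf A d (\<lambda>_. p)) (plug_in_excess_sum p A) \<le>
    real (card A) * measure_pmf.expectation p
      (\<lambda>y. measure_pmf.expectation (binomial_pmf (card A - 1) (pmf p y))
        (\<lambda>c. (plug_in_excess (card A - 1) (pmf p y) c)\<^sup>2))"
proof -
  let ?P = "Pi_pmf A d (\<lambda>_. p)"
  let ?D = "\<lambda>i x. plug_in_excess (card A - 1) (pmf p (x i)) (card {l\<in>A - {i}. x l = x i})"
  \<comment> \<open>By \<open>plug_in_excess_sum_insert\<close>, what remains after removing
    \<open>?D i\<close> does not involve \<open>x i\<close>, as Efron--Stein requires.\<close>
  define g where "g i x = plug_in_excess_sum p A x - ?D i x" for i x
  have g: "g i x = real (card (A - {i})) * harm (card (A - {i})) - 1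
      - (\<Sum>k\<in>A - {i}. harm (card {l\<in>A - {i}. x l = x k} - 1)) + (\<Sum>k\<in>A - {i}. ln (pmf p (x k)))"
    if "i \<in> A" for i x
    using plug_in_excess_sum_insert[of "A - {i}" i p x] A that
    by (simp add: g_def insert_absorb card_Diff_singleton)
  have D2: "integrable (measure_pmf ?P) (\<lambda>x. (?D i x)\<^sup>2)" if i: "i \<in> A" for i
  proof -
    have "integrable (measure_pmf ?P) (\<lambda>x. (harm (card A - 1) - harm (card {l\<in>A - {i}. x l = x i})
        + of_bool (card {l\<in>A - {i}. x l = x i} = 0) + ln (pmf p (x i)))\<^sup>2)"
      by (intro square_integrable_add square_integrable_ln_pmf_component A i
        square_integrable_multiplicity[where A = "A - {i}"
          and f = "\<lambda>c. harm (card A - 1) - harm c + of_bool (c = 0)"]) (use A in auto)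
    then show ?thesis by (simp add: plug_in_excess_def add_ac)
  qed
  have "measure_pmf.variance ?P (plug_in_excess_sum p A) \<le>
    (\<Sum>i\<in>A. measure_pmf.expectation ?P (\<lambda>x. (plug_in_excess_sum p A x - g i x)\<^sup>2))"
  proof (rule efron_stein_Pi_pmf)
    show "integrable (measure_pmf ?P) (\<lambda>x. (g i x)\<^sup>2)" if "i \<in> A" for i
      unfolding g_def
      by (intro square_integrable_diff square_integrable_plug_in_excess_sum D2 that A) auto
    show "g i (x(i := y)) = g i x" if i: "i \<in> A" for i x y
    proof -
      have "(x(i := y)) k = x k" if "k \<in> A - {i}" for k using that by simp
      then show ?thesis
        unfolding g[OF i] by (intro arg_cong2[where f = "(+)"] arg_cong2[where f = "(-)"] refl sum.cong
          arg_cong[where f = harm] arg_cong2[where f = "(-) :: nat \<Rightarrow> _"] arg_cong[where f = card]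
          Collect_cong conj_cong) auto
    qed
  qed (use A square_integrable_plug_in_excess_sum in auto)
  also have "\<dots> = (\<Sum>i\<in>A. measure_pmf.expectation p
      (\<lambda>y. measure_pmf.expectation (binomial_pmf (card A - 1) (pmf p y))
        (\<lambda>c. (plug_in_excess (card A - 1) (pmf p y) c)\<^sup>2)))"
  proof (intro sum.cong refl)
    fix i assume i: "i \<in> A"
    then have ins: "insert i (A - {i}) = A" by auto
    show "measure_pmf.expectation ?P (\<lambda>x. (plug_in_excess_sum p A x - g i x)\<^sup>2) =
      measure_pmf.expectation p (\<lambda>y. measure_pmf.expectation (binomial_pmf (card A - 1) (pmf p y))
        (\<lambda>c. (plug_in_excess (card A - 1) (pmf p y) c)\<^sup>2))"
      using expectation_multiplicity_Pi_pmf[of "A - {i}" i d p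
          "\<lambda>y c. (plug_in_excess (card A - 1) (pmf p y) c)\<^sup>2"] D2[OF i] A i
      unfolding ins by (simp add: g_def card_Diff_singleton)
  qed
  finally show ?thesis by simp
qed

text \<open>In each summand the count of the other observations is conditionally binomial, so the
  mean is exact: the harmonic numbers cancel and the remainder of the logarithmic series is
  left.\<close>

lemma expectation_plug_in_excess_sum:
  assumes A: "finite A"
  shows "measure_pmf.expectation (Pi_pmf A d (\<lambda>_. p)) (plug_in_excess_sum p A) =
    - real (card A) * measure_pmf.expectation p (\<lambda>y. log_tail (card A - 1) (pmf p y))"
proof -
  let ?P = "Pi_pmf A d (\<lambda>_. p)"
  let ?h = "\<lambda>y c. harm (card A - 1) - harm c + ln (pmf p y)"
  have int: "integrable (measure_pmf ?P) (\<lambda>x. ?h (x i) (card {l\<in>A - {i}. x l = x i}))" if i: "i \<in> A" for i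
    by (rule integrable_measure_pmf_of_square, intro square_integrable_add square_integrable_ln_pmf_component A i
        square_integrable_multiplicity[where A = "A - {i}" and f = "\<lambda>c. harm (card A - 1) - harm c"])
       (use A in auto)
  \<comment> \<open>The multiplicity of \<open>x i\<close> counts \<open>i\<close> itself;
    subtracting \<open>1\<close> leaves the count of the others.\<close>
  have summand: "harm (card A - 1) - harm (card {l\<in>A. x l = x i} - 1) + ln (pmf p (x i)) =
    ?h (x i) (card {l\<in>A - {i}. x l = x i})" if "i \<in> A" for i x
  proof -
    have "{l\<in>A. x l = x i} = insert i {l\<in>A - {i}. x l = x i}" using that by auto
    then show ?thesis using A by simp
  qed
  have "measure_pmf.expectation ?P (plug_in_excess_sum p A) =
    measure_pmf.expectation ?P (\<lambda>x. \<Sum>i\<in>A. ?h (x i) (card {l\<in>A - {i}. x l = x i}))"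
    unfolding plug_in_excess_sum_def by (intro arg_cong[where f = "measure_pmf.expectation ?P"] ext sum.cong refl summand)
  also have "\<dots> = (\<Sum>i\<in>A. measure_pmf.expectation ?P (\<lambda>x. ?h (x i) (card {l\<in>A - {i}. x l = x i})))"
    by (rule Bochner_Integration.integral_sum) (rule int)
  also have "\<dots> = (\<Sum>i\<in>A. measure_pmf.expectation p (\<lambda>y. - log_tail (card A - 1) (pmf p y)))"
  proof (intro sum.cong refl)
    fix i assume i: "i \<in> A"
    then have ins: "insert i (A - {i}) = A" by auto
    have "measure_pmf.expectation ?P (\<lambda>x. ?h (x i) (card {l\<in>A - {i}. x l = x i})) =
      measure_pmf.expectation p (\<lambda>y. measure_pmf.expectation (binomial_pmf (card A - 1) (pmf p y)) (?h y))"
      using expectation_multiplicity_Pi_pmf[of "A - {i}" i d p ?h] int[OF i] A i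
      unfolding ins by (simp add: card_Diff_singleton)
    also have "\<dots> = measure_pmf.expectation p (\<lambda>y. - log_tail (card A - 1) (pmf p y))"
    proof (intro arg_cong[where f = "measure_pmf.expectation p"] ext)
      fix y
      have q: "pmf p y \<in> {0..1}" by (simp add: pmf_le_1)
      have "integrable (measure_pmf (binomial_pmf (card A - 1) (pmf p y))) (harm :: nat \<Rightarrow> real)"
        using q by auto
      then show "measure_pmf.expectation (binomial_pmf (card A - 1) (pmf p y)) (?h y) =
        - log_tail (card A - 1) (pmf p y)"
        by (simp add: expectation_harm_binomial[OF q] log_tail_def)
    qed
    finally show "measure_pmf.expectation ?P (\<lambda>x. ?h (x i) (card {l\<in>A - {i}. x l = x i})) =
      measure_pmf.expectation p (\<lambda>y. - log_tail (card A - 1) (pmf p y))" .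
  qed
  also have "\<dots> = - real (card A) * measure_pmf.expectation p (\<lambda>y. log_tail (card A - 1) (pmf p y))"
    by simp
  finally show ?thesis .
qed

lemma expectation_square_plug_in_excess_pmf_tendsto_0:
  "(\<lambda>m. measure_pmf.expectation p (\<lambda>y. measure_pmf.expectation (binomial_pmf m (pmf p y))
        (\<lambda>c. (plug_in_excess m (pmf p y) c)\<^sup>2))) \<longlonglongrightarrow> 0"
proof -
  have "(\<lambda>m. measure_pmf.expectation p (\<lambda>y. measure_pmf.expectation (binomial_pmf m (pmf p y))
        (\<lambda>c. (plug_in_excess m (pmf p y) c)\<^sup>2))) \<longlonglongrightarrow> measure_pmf.expectation p (\<lambda>y. 0)"
  proof (rule integral_dominated_convergence[where w = "\<lambda>y. 4 + 2 * (ln (pmf p y))\<^sup>2"])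
    show "integrable (measure_pmf p) (\<lambda>y. 4 + 2 * (ln (pmf p y))\<^sup>2)"
      using integrable_square_ln_pmf[OF o] by simp
    show "AE y in measure_pmf p. (\<lambda>m. measure_pmf.expectation (binomial_pmf m (pmf p y))
        (\<lambda>c. (plug_in_excess m (pmf p y) c)\<^sup>2)) \<longlonglongrightarrow> 0"
      by (intro AE_pmfI expectation_square_plug_in_excess_tendsto_0) (auto simp: pmf_positive pmf_le_1)
    show "AE y in measure_pmf p. norm (measure_pmf.expectation (binomial_pmf m (pmf p y))
        (\<lambda>c. (plug_in_excess m (pmf p y) c)\<^sup>2)) \<le> 4 + 2 * (ln (pmf p y))\<^sup>2" for m
      using expectation_square_plug_in_excess_le_ln[of "pmf p _" m]
      by (intro AE_pmfI) (auto simp: pmf_positive pmf_le_1)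
  qed auto
  then show ?thesis by simp
qed

text \<open>Variance plus squared mean: divided by \<open>n\<close>, the first is at most the mean
  square effect of one observation, and the second is \<open>n\<close> times the square of a mean
  that is \<open>o(1 / sqrt n)\<close>.\<close>

lemma expectation_square_plug_in_excess_sum_tendsto_0:
  "(\<lambda>n. measure_pmf.expectation (Pi_pmf {1..n} d (\<lambda>_. p)) (\<lambda>x. (plug_in_excess_sum p {1..n} x)\<^sup>2) / real n)
    \<longlonglongrightarrow> 0"
proof (rule LIMSEQ_imp_Suc, rule tendsto_sandwich[where f = "\<lambda>_. 0"])
  let ?v = "\<lambda>m. measure_pmf.expectation p (\<lambda>y. measure_pmf.expectation (binomial_pmf m (pmf p y))
        (\<lambda>c. (plug_in_excess m (pmf p y) c)\<^sup>2))"
  let ?b = "\<lambda>m. measure_pmf.expectation p (\<lambda>y. log_tail m (pmf p y))"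
  \<comment> \<open>Here \<open>n = Suc m\<close>, so the counts have \<open>m\<close> trials; the
    factor \<open>1 + 1 / m\<close> converts \<open>Suc m\<close> into \<open>m\<close>.\<close>
  let ?ub = "\<lambda>m. ?v m + (1 + 1 / real m) * (sqrt (real m) * ?b m)\<^sup>2"
  have "?ub \<longlonglongrightarrow> 0 + (1 + 0) * 0\<^sup>2"
    by (intro tendsto_add tendsto_mult tendsto_power tendsto_const lim_1_over_n
      expectation_log_tail_tendsto_0[OF o] expectation_square_plug_in_excess_pmf_tendsto_0)
  then show "?ub \<longlonglongrightarrow> 0" by simp
  show "eventually (\<lambda>m. measure_pmf.expectation (Pi_pmf {1..Suc m} d (\<lambda>_. p))
      (\<lambda>x. (plug_in_excess_sum p {1..Suc m} x)\<^sup>2) / real (Suc m) \<le> ?ub m) sequentially"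
    using eventually_gt_at_top[of 0]
  proof eventually_elim
    case (elim m)
    let ?P = "Pi_pmf {1..Suc m} d (\<lambda>_. p)" and ?f = "plug_in_excess_sum p {1..Suc m}"
    have i2: "integrable (measure_pmf ?P) (\<lambda>x. (?f x)\<^sup>2)"
      by (rule square_integrable_plug_in_excess_sum) simp
    have "measure_pmf.expectation ?P (\<lambda>x. (?f x)\<^sup>2) =
      measure_pmf.variance ?P ?f + (measure_pmf.expectation ?P ?f)\<^sup>2"
      using measure_pmf.variance_eq[OF integrable_measure_pmf_of_square[OF i2] i2] by simp
    also have "\<dots> \<le> real (Suc m) * ?v m + (real (Suc m) * ?b m)\<^sup>2"
      using variance_plug_in_excess_sum_le[of "{1..Suc m}" d] expectation_plug_in_excess_sum[of "{1..Suc m}" d]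
      by (simp add: power_mult_distrib del: of_nat_Suc)
    also have "\<dots> = real (Suc m) * (?v m + real (Suc m) * (?b m)\<^sup>2)"
      by (simp add: power2_eq_square algebra_simps)
    also have "real (Suc m) * (?b m)\<^sup>2 = (1 + 1 / real m) * (sqrt (real m) * ?b m)\<^sup>2"
      using elim by (simp add: power_mult_distrib field_simps)
    finally show ?case by (simp add: divide_le_eq mult.commute del: of_nat_Suc)
  qed
qed auto

end


section \<open>Passage to the sample and the limit law\<close>

lemma (in prob_space) indep_vars_reindex_inj:
  assumes ind: "indep_vars M' X (h ` I)" and inj: "inj_on h I"
  shows "indep_vars (\<lambda>i. M' (h i)) (\<lambda>i. X (h i)) I"
  unfolding indep_vars_def2
proof (intro conjI ballI indep_setsI)
  have X: "\<And>i. i \<in> h ` I \<Longrightarrow> random_variable (M' i) (X i)"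
    and ind': "indep_sets (\<lambda>i. {X i -` A \<inter> space M |A. A \<in> sets (M' i)}) (h ` I)"
    using ind unfolding indep_vars_def2 by auto
  show "random_variable (M' (h i)) (X (h i))" if "i \<in> I" for i
    using X that by simp
  then show "{X (h i) -` A \<inter> space M |A. A \<in> sets (M' (h i))} \<subseteq> events" if "i \<in> I" for i
    using that by (auto intro: measurable_sets)
  fix A J
  assume J: "J \<noteq> {}" "J \<subseteq> I" "finite J"
    and A: "\<forall>j\<in>J. A j \<in> {X (h j) -` B \<inter> space M |B. B \<in> sets (M' (h j))}"
  have injJ: "inj_on h J" using inj J by (auto intro: inj_on_subset)
  have inv: "the_inv_into J h (h j) = j" if "j \<in> J" for j
    using injJ that by (rule the_inv_into_f_f)
  have "prob (\<Inter>k\<in>h ` J. A (the_inv_into J h k)) = (\<Prod>k\<in>h ` J. prob (A (the_inv_into J h k)))"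
    by (rule indep_setsD[OF ind']) (use J A inv in auto)
  then show "prob (\<Inter>j\<in>J. A j) = (\<Prod>j\<in>J. prob (A j))"
    by (simp add: inv prod.reindex[OF injJ])
qed

text \<open>The sample under \<open>M\<close> and the coordinates under \<open>Pi_pmf\<close> have
  the same law on the product space, and \<open>f\<close> factors through the restriction to
  \<open>I\<close>. Countability of the value type makes the finite product discrete, so every
  \<open>f\<close> is measurable on it.\<close>

lemma (in prob_space)
  fixes X :: "'i \<Rightarrow> 'a \<Rightarrow> 'b :: countable" and f :: "('i \<Rightarrow> 'b) \<Rightarrow> real"
  assumes I: "finite I" "I \<noteq> {}"
    and ind: "indep_vars (\<lambda>_. count_space UNIV) X I"
    and distr: "\<And>i. i \<in> I \<Longrightarrow> distr M (count_space UNIV) (X i) = measure_pmf p"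
    and f: "\<And>x. f (restrict x I) = f x"
  shows borel_measurable_iid_sample: "(\<lambda>\<omega>. f (\<lambda>i. X i \<omega>)) \<in> borel_measurable M"
    and integrable_iid_sample_iff: "integrable M (\<lambda>\<omega>. f (\<lambda>i. X i \<omega>)) \<longleftrightarrow>
      integrable (measure_pmf (Pi_pmf I d (\<lambda>_. p))) f"
    and expectation_iid_sample: "expectation (\<lambda>\<omega>. f (\<lambda>i. X i \<omega>)) =
      measure_pmf.expectation (Pi_pmf I d (\<lambda>_. p)) f"
proof -
  let ?N = "PiM I (\<lambda>_. count_space UNIV :: 'b measure)" and ?P = "Pi_pmf I d (\<lambda>_. p)"
  have X: "X i \<in> measurable M (count_space UNIV)" if "i \<in> I" for i
    using ind that unfolding indep_vars_def2 by auto
  have N: "?N = count_space (PiE I (\<lambda>_. UNIV))"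
    using I by (intro count_space_PiM_finite) auto
  have fN: "f \<in> borel_measurable ?N" unfolding N by simp
  have XN: "(\<lambda>\<omega>. \<lambda>i\<in>I. X i \<omega>) \<in> measurable M ?N"
    by (rule measurable_restrict) (rule X)
  have rN: "(\<lambda>x. \<lambda>i\<in>I. x i) \<in> measurable (measure_pmf ?P) ?N"
    by (rule measurable_restrict) simp
  have "distr M ?N (\<lambda>\<omega>. \<lambda>i\<in>I. X i \<omega>) = PiM I (\<lambda>i. distr M (count_space UNIV) (X i))"
    using ind by (subst (asm) indep_vars_iff_distr_eq_PiM'[OF I(2) X])
  also have "\<dots> = PiM I (\<lambda>_. measure_pmf p)"
    by (intro PiM_cong refl distr)
  also have "\<dots> = PiM I (\<lambda>i. distr (measure_pmf ?P) (count_space UNIV) (\<lambda>x. x i))"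
  proof (intro PiM_cong refl)
    fix i assume "i \<in> I"
    then have "map_pmf (\<lambda>x. x i) ?P = p" using I by (simp add: Pi_pmf_component)
    then show "measure_pmf p = distr (measure_pmf ?P) (count_space UNIV) (\<lambda>x. x i)"
      by (metis map_pmf_rep_eq)
  qed
  also have "\<dots> = distr (measure_pmf ?P) ?N (\<lambda>x. \<lambda>i\<in>I. x i)"
    using indep_vars_Pi_pmf[OF I(1), of d "\<lambda>_. p"]
    by (subst (asm) prob_space.indep_vars_iff_distr_eq_PiM'[OF measure_pmf.prob_space_axioms I(2)]) auto
  finally have eq: "distr M ?N (\<lambda>\<omega>. \<lambda>i\<in>I. X i \<omega>) = distr (measure_pmf ?P) ?N (\<lambda>x. \<lambda>i\<in>I. x i)" .
  have fX: "f (\<lambda>i\<in>I. X i \<omega>) = f (\<lambda>i. X i \<omega>)" for \<omega>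
    by (rule f)
  show "(\<lambda>\<omega>. f (\<lambda>i. X i \<omega>)) \<in> borel_measurable M"
    using measurable_compose[OF XN fN] by (simp add: fX)
  show "integrable M (\<lambda>\<omega>. f (\<lambda>i. X i \<omega>)) \<longleftrightarrow> integrable (measure_pmf ?P) f"
    using arg_cong[OF eq, of "\<lambda>D. integrable D f"] fN XN rN
    by (simp add: integrable_distr_eq fX f)
  show "expectation (\<lambda>\<omega>. f (\<lambda>i. X i \<omega>)) = measure_pmf.expectation ?P f"
    using arg_cong[OF eq, of "\<lambda>D. integral\<^sup>L D f"] fN XN rN
    by (simp add: integral_distr fX f)
qed

section \<open>Characteristic functions and the central limit theorem\<close>

lemma real_distribution_normal_law:
  assumes "v \<ge> 0"
  shows "real_distribution (normal_law \<mu> v)"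
proof (cases "v = 0")
  case True
  then show ?thesis
    by (auto simp: normal_law_def real_distribution_def real_distribution_axioms_def intro!: prob_space_return)
next
  case False
  then show ?thesis using assms prob_space_normal_density[of "sqrt v" \<mu>]
    by (auto simp: normal_law_def real_distribution_def real_distribution_axioms_def)
qed

text \<open>A centred normal variable is \<open>sqrt v\<close> times a standard one; for
  \<open>v = 0\<close> both sides equal \<open>1\<close>.\<close>

lemma char_normal_law:
  assumes "v \<ge> 0"
  shows "char (normal_law 0 v) t = char std_normal_distribution (sqrt v * t)"
proof (cases "v = 0")
  case True
  interpret real_distribution std_normal_distribution by (rule real_dist_normal_dist)
  show ?thesis
    using True char_zero by (simp add: normal_law_def char_def[of "return borel 0"] integral_return)
next
  case False
  interpret real_distribution std_normal_distribution by (rule real_dist_normal_dist)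
  have "distributed std_normal_distribution lborel (\<lambda>x. x) std_normal_density"
    by (auto simp: distributed_def distr_id2)
  from normal_density_affine[OF this, of "sqrt v" 0]
  have "distr std_normal_distribution lborel (\<lambda>x. sqrt v * x) = normal_law 0 v"
    using assms False by (simp add: distributed_def normal_law_def)
  then have "char (normal_law 0 v) t = char (distr std_normal_distribution lborel (\<lambda>x. sqrt v * x)) t"
    by simp
  also have "\<dots> = char std_normal_distribution (sqrt v * t)"
    unfolding char_def by (subst integral_distr) (auto simp: mult_ac)
  finally show ?thesis .
qed

lemma norm_iexp_diff_le: "norm (iexp a - iexp b) \<le> \<bar>a - b\<bar>"
proof -
  have "iexp b * iexp (a - b) = iexp (b + (a - b))"
    by (simp only: of_real_add distrib_left exp_add)
  then have "iexp a - iexp b = iexp b * (iexp (a - b) - 1)"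
    by (simp add: right_diff_distrib del: of_real_diff)
  then have "norm (iexp a - iexp b) = norm (iexp (a - b) - 1)"
    by (simp add: norm_mult del: of_real_diff)
  also have "\<dots> \<le> \<bar>a - b\<bar>"
    using iexp_approx1[of "a - b" 0] by simp
  finally show ?thesis .
qed

text \<open>Since \<open>iexp\<close> is 1-Lipschitz, the two characteristic functions at
  \<open>t\<close> differ by at most \<open>\<bar>t\<bar>\<close> times the L1 distance. This plays
  the part of Slutsky's theorem.\<close>

lemma (in prob_space) char_distr_tendsto_of_L1_approx:
  fixes Y W :: "nat \<Rightarrow> 'a \<Rightarrow> real"
  assumes Y: "\<And>n. random_variable borel (Y n)" and W: "\<And>n. random_variable borel (W n)"
    and int: "\<And>n. integrable M (\<lambda>\<omega>. Y n \<omega> - W n \<omega>)"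
    and lim: "(\<lambda>n. expectation (\<lambda>\<omega>. \<bar>Y n \<omega> - W n \<omega>\<bar>)) \<longlonglongrightarrow> 0"
    and char: "(\<lambda>n. char (distr M borel (W n)) t) \<longlonglongrightarrow> c"
  shows "(\<lambda>n. char (distr M borel (Y n)) t) \<longlonglongrightarrow> c"
proof -
  note [measurable] = Y W
  have ci: "integrable M (\<lambda>\<omega>. iexp (t * Z \<omega>))" if "random_variable borel Z" for Z :: "'a \<Rightarrow> real"
    using that by (intro integrable_const_bound[where B = 1]) auto
  have le: "norm (char (distr M borel (Y n)) t - char (distr M borel (W n)) t) \<le>
    \<bar>t\<bar> * expectation (\<lambda>\<omega>. \<bar>Y n \<omega> - W n \<omega>\<bar>)" for n
  proof -
    have "char (distr M borel (Y n)) t - char (distr M borel (W n)) t =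
      (CLINT \<omega>|M. iexp (t * Y n \<omega>) - iexp (t * W n \<omega>))"
      unfolding char_def using ci[OF Y] ci[OF W] by (simp add: integral_distr)
    also have "norm \<dots> \<le> expectation (\<lambda>\<omega>. norm (iexp (t * Y n \<omega>) - iexp (t * W n \<omega>)))"
      by (rule integral_norm_bound)
    also have "\<dots> \<le> expectation (\<lambda>\<omega>. \<bar>t\<bar> * \<bar>Y n \<omega> - W n \<omega>\<bar>)"
    proof (rule integral_mono)
      show "integrable M (\<lambda>\<omega>. norm (iexp (t * Y n \<omega>) - iexp (t * W n \<omega>)))"
        using ci[OF Y] ci[OF W] by (intro integrable_norm Bochner_Integration.integrable_diff)
      show "norm (iexp (t * Y n \<omega>) - iexp (t * W n \<omega>)) \<le> \<bar>t\<bar> * \<bar>Y n \<omega> - W n \<omega>\<bar>" for \<omega>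
        using norm_iexp_diff_le[of "t * Y n \<omega>" "t * W n \<omega>"]
        unfolding right_diff_distrib[symmetric] abs_mult .
    qed (use int in auto)
    finally show ?thesis by simp
  qed
  have lim0: "(\<lambda>n. \<bar>t\<bar> * expectation (\<lambda>\<omega>. \<bar>Y n \<omega> - W n \<omega>\<bar>)) \<longlonglongrightarrow> 0"
    using tendsto_mult_right_zero[OF lim] .
  have "(\<lambda>n. char (distr M borel (Y n)) t - char (distr M borel (W n)) t) \<longlonglongrightarrow> 0"
    by (rule Lim_null_comparison[OF always_eventually[OF allI[OF le]] lim0])
  from tendsto_add[OF this char] show ?thesis by simp
qed

text \<open>For \<open>v > 0\<close> this is the central limit theorem with \<open>t\<close>
  rescaled by \<open>sqrt v\<close>. For \<open>v = 0\<close> the variables vanish almost surely and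
  both sides equal \<open>1\<close>.\<close>

lemma (in prob_space) char_normalized_sum_tendsto:
  fixes Y :: "nat \<Rightarrow> 'a \<Rightarrow> real"
  assumes ind: "indep_vars (\<lambda>_. borel) Y UNIV"
    and mean: "\<And>n. expectation (Y n) = 0"
    and square: "\<And>n. integrable M (\<lambda>\<omega>. (Y n \<omega>)\<^sup>2)"
    and var: "\<And>n. expectation (\<lambda>\<omega>. (Y n \<omega>)\<^sup>2) = v"
    and distr: "\<And>n. distr M borel (Y n) = \<mu>"
  shows "(\<lambda>n. char (distr M borel (\<lambda>\<omega>. (\<Sum>i<n. Y i \<omega>) / sqrt (real n))) t) \<longlonglongrightarrow> char (normal_law 0 v) t"
proof -
  have Y [measurable]: "random_variable borel (Y n)" for n
    using ind unfolding indep_vars_def2 by auto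
  have v: "v \<ge> 0" using var[of 0, symmetric] by simp
  show ?thesis
  proof (cases "v = 0")
    case True
    have "AE \<omega> in M. (Y n \<omega>)\<^sup>2 = 0" for n
      using integral_nonneg_eq_0_iff_AE[OF square[of n]] var[of n] True by auto
    then have "AE \<omega> in M. \<forall>n. Y n \<omega> = 0"
      by (subst AE_all_countable) auto
    then have ae: "AE \<omega> in M. (\<Sum>i<n. Y i \<omega>) / sqrt (real n) = 0" for n
      by eventually_elim auto
    have "char (distr M borel (\<lambda>\<omega>. (\<Sum>i<n. Y i \<omega>) / sqrt (real n))) t = 1" for n
    proof -
      have "(CLINT \<omega>|M. iexp (t * ((\<Sum>i<n. Y i \<omega>) / sqrt (real n)))) = (CLINT \<omega>|M. 1)"
      proof (rule integral_cong_AE)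
        show "AE \<omega> in M. iexp (t * ((\<Sum>i<n. Y i \<omega>) / sqrt (real n))) = 1"
          using ae[of n] by eventually_elim (simp only: mult_zero_right of_real_0 exp_zero)
      qed measurable
      then show ?thesis unfolding char_def by (subst integral_distr) (auto simp: prob_space)
    qed
    moreover have "char (normal_law 0 v) t = 1"
      using real_distribution.char_zero[OF real_dist_normal_dist] True by (simp add: char_normal_law)
    ultimately show ?thesis by simp
  next
    case False
    then have v: "v > 0" using v by simp
    have "weak_conv_m (\<lambda>n. distr M borel (\<lambda>\<omega>. (\<Sum>i<n. Y i \<omega>) / sqrt (real n * (sqrt v)\<^sup>2))) std_normal_distribution"
      by (rule central_limit_theorem_zero_mean[OF ind mean _ square _ distr])
         (use v mean var in auto)
    then have "(\<lambda>n. char (distr M borel (\<lambda>\<omega>. (\<Sum>i<n. Y i \<omega>) / sqrt (real n * (sqrt v)\<^sup>2))) (sqrt v * t))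
      \<longlonglongrightarrow> char std_normal_distribution (sqrt v * t)"
      by (intro levy_continuity1 real_dist_normal_dist) auto
    moreover have "char (distr M borel (\<lambda>\<omega>. (\<Sum>i<n. Y i \<omega>) / sqrt (real n * (sqrt v)\<^sup>2))) (sqrt v * t) =
      char (distr M borel (\<lambda>\<omega>. (\<Sum>i<n. Y i \<omega>) / sqrt (real n))) t" for n
    proof -
      have "sqrt v * t * (s / sqrt (real n * (sqrt v)\<^sup>2)) = t * (s / sqrt (real n))" for s
        using v by (simp add: real_sqrt_mult)
      then show ?thesis unfolding char_def by (subst (1 2) integral_distr) (auto simp del: of_real_mult)
    qed
    ultimately show ?thesis using v by (simp add: char_normal_law)
  qed
qed

section \<open>Decomposition of the estimator and conclusion\<close>

lemma plug_in_excess_sum_restrict: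
  "plug_in_excess_sum p A (restrict x A) = plug_in_excess_sum p A x"
proof -
  have "{l\<in>A. restrict x A l = restrict x A k} = {l\<in>A. x l = x k}" if "k \<in> A" for k
    using that by auto
  then show ?thesis
    unfolding plug_in_excess_sum_def by (intro sum.cong refl) simp
qed

lemma harmonic_entropy_estimator_eq:
  "harmonic_entropy_estimator n x =
    (plug_in_excess_sum p {1..n} x - (\<Sum>i = 1..n. ln (pmf p (x i)))) / real n"
proof -
  have "occurrences n x i = card {k\<in>{1..n}. x k = x i}" for i
    unfolding occurrences_def by (subst sum_of_bool_eq) (auto intro!: arg_cong[where f = card])
  then show ?thesis
    by (simp add: harmonic_entropy_estimator_def plug_in_excess_sum_def sum.distrib)
qed

theorem theoremI2:
  fixes p :: "nat pmf" and M :: "'a measure" and X :: "nat \<Rightarrow> 'a \<Rightarrow> nat"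
  assumes "pmf p 0 = 0"
    and "(\<lambda>j. pmf p j) \<in> o[at_top](\<lambda>j. 1 / real j ^ 2)"
    and "prob_space M"
    and "prob_space.indep_vars M (\<lambda>_. count_space UNIV) X {1..}"
    and "\<And>i. i \<ge> 1 \<Longrightarrow> distr M (count_space UNIV) (X i) = measure_pmf p"
  shows "weak_conv_m
    (\<lambda>n. distr M borel
      (\<lambda>\<omega>. sqrt (real n) * (harmonic_entropy_estimator n (\<lambda>i. X i \<omega>) - shannon_entropy p)))
    (normal_law 0 (measure_pmf.variance p (\<lambda>x. ln (pmf p x))))"
proof -
  interpret prob_space M by fact
  note o = assms(2) and ind = assms(4)
  define a where "a = measure_pmf.expectation p (\<lambda>x. ln (pmf p x))"
  let ?v = "measure_pmf.variance p (\<lambda>x. ln (pmf p x))"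
  define e where "e n \<omega> = plug_in_excess_sum p {1..n} (\<lambda>i. X i \<omega>)" for n \<omega>
  let ?Y = "\<lambda>n \<omega>. sqrt (real n) * (harmonic_entropy_estimator n (\<lambda>i. X i \<omega>) - shannon_entropy p)"
  \<comment> \<open>Centred values of \<open>- ln p\<close>, reindexed from
    \<open>0\<close>.\<close>
  define Z where "Z i \<omega> = a - ln (pmf p (X (Suc i) \<omega>))" for i \<omega>
  define W where "W n \<omega> = (\<Sum>i<n. Z i \<omega>) / sqrt (real n)" for n \<omega>
  have X [measurable]: "X (Suc i) \<in> measurable M (count_space UNIV)" for i
    using ind unfolding indep_vars_def2 by auto
  have Z [measurable]: "random_variable borel (Z i)" for i
    unfolding Z_def by measurable
  have W: "random_variable borel (W n)" for n
    unfolding W_def by measurable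
  have dX: "distr M (count_space UNIV) (X (Suc i)) = measure_pmf p" for i
    by (rule assms(5)) simp
  note l2 = integrable_square_ln_pmf[OF o]
  note l1 = integrable_measure_pmf_of_square[OF l2]

  \<comment> \<open>The normalised error is the sum governed by the central limit theorem plus a
    remainder. At \<open>n = 0\<close> all terms vanish because division by zero gives
    \<open>0\<close>.\<close>
  have Y_eq: "?Y n \<omega> = W n \<omega> + e n \<omega> / sqrt (real n)" for n \<omega>
  proof (cases "n = 0")
    case False
    then have n: "sqrt (real n) > 0" "real n = sqrt (real n) * sqrt (real n)" by auto
    have "(\<Sum>i<n. Z i \<omega>) = real n * a - (\<Sum>i = 1..n. ln (pmf p (X i \<omega>)))"
      by (simp add: Z_def sum_subtractf sum.atLeast1_atMost_eq)
    moreover have "shannon_entropy p = - a" by (simp add: shannon_entropy_def a_def)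
    moreover have "sqrt (real n) * ((E - L) / real n + a) = (real n * a - L) / sqrt (real n) + E / sqrt (real n)"
      for E L
      by (subst (2 3) n(2)) (use n(1) in \<open>simp add: field_simps\<close>)
    ultimately show ?thesis
      by (simp add: harmonic_entropy_estimator_eq[of n _ p] W_def e_def)
  qed (simp add: W_def)

  have sample: "e n \<in> borel_measurable M"
      "integrable M (\<lambda>\<omega>. (e n \<omega>)\<^sup>2)"
      "expectation (\<lambda>\<omega>. (e n \<omega>)\<^sup>2) =
        measure_pmf.expectation (Pi_pmf {1..n} 0 (\<lambda>_. p)) (\<lambda>x. (plug_in_excess_sum p {1..n} x)\<^sup>2)" for n
  proof -
    have "e n \<in> borel_measurable M \<and> integrable M (\<lambda>\<omega>. (e n \<omega>)\<^sup>2) \<and>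
      expectation (\<lambda>\<omega>. (e n \<omega>)\<^sup>2) =
        measure_pmf.expectation (Pi_pmf {1..n} 0 (\<lambda>_. p)) (\<lambda>x. (plug_in_excess_sum p {1..n} x)\<^sup>2)"
    \<comment> \<open>The transfer to the product law requires a nonempty index set; for
      \<open>n = 0\<close> the sum is empty.\<close>
    proof (cases "n = 0")
      case False
      then have I: "finite {1..n}" "{1..n} \<noteq> {}" by auto
      have indn: "indep_vars (\<lambda>_. count_space UNIV) X {1..n}"
        using ind by (rule indep_vars_subset) auto
      have d: "distr M (count_space UNIV) (X i) = measure_pmf p" if "i \<in> {1..n}" for i
        using that by (intro assms(5)) simp
      show ?thesis
        using borel_measurable_iid_sample[OF I indn d, where f = "plug_in_excess_sum p {1..n}"]
          integrable_iid_sample_iff[OF I indn d, where f = "\<lambda>x. (plug_in_excess_sum p {1..n} x)\<^sup>2" and d = 0]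
          expectation_iid_sample[OF I indn d, where f = "\<lambda>x. (plug_in_excess_sum p {1..n} x)\<^sup>2" and d = 0]
          square_integrable_plug_in_excess_sum[OF o, of "{1..n}" 0]
        by (simp add: plug_in_excess_sum_restrict e_def[abs_def])
    next
      case True
      then have "plug_in_excess_sum p {1..n} = (\<lambda>_. 0)" and "e n = (\<lambda>_. 0)"
        by (simp_all add: fun_eq_iff e_def plug_in_excess_sum_def)
      then show ?thesis by simp
    qed
    then show "e n \<in> borel_measurable M" "integrable M (\<lambda>\<omega>. (e n \<omega>)\<^sup>2)"
      "expectation (\<lambda>\<omega>. (e n \<omega>)\<^sup>2) =
        measure_pmf.expectation (Pi_pmf {1..n} 0 (\<lambda>_. p)) (\<lambda>x. (plug_in_excess_sum p {1..n} x)\<^sup>2)"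
      by blast+
  qed
  have e1: "integrable M (e n)" for n
    by (rule square_integrable_imp_integrable[OF sample(1,2)])
  have Y: "random_variable borel (?Y n)" for n
    unfolding Y_eq
    by (intro borel_measurable_add borel_measurable_divide borel_measurable_const W sample(1))

  \<comment> \<open>The L1 norm is at most the L2 norm, which is \<open>o(sqrt n)\<close> for
    \<open>e n\<close>.\<close>
  have "(\<lambda>n. expectation (\<lambda>\<omega>. \<bar>?Y n \<omega> - W n \<omega>\<bar>)) \<longlonglongrightarrow> 0"
  proof (rule tendsto_sandwich[where f = "\<lambda>_. 0"])
    show "(\<lambda>n. sqrt (expectation (\<lambda>\<omega>. (e n \<omega>)\<^sup>2) / real n)) \<longlonglongrightarrow> 0"
      using tendsto_real_sqrt[OF expectation_square_plug_in_excess_sum_tendsto_0[OF o, of 0]]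
      unfolding sample(3) real_sqrt_zero .
    show "\<forall>\<^sub>F n in sequentially. expectation (\<lambda>\<omega>. \<bar>?Y n \<omega> - W n \<omega>\<bar>) \<le>
      sqrt (expectation (\<lambda>\<omega>. (e n \<omega>)\<^sup>2) / real n)"
    proof (intro always_eventually allI)
      fix n
      have "(expectation (\<lambda>\<omega>. \<bar>e n \<omega>\<bar>))\<^sup>2 \<le> expectation (\<lambda>\<omega>. (e n \<omega>)\<^sup>2)"
        using variance_eq[of "\<lambda>\<omega>. \<bar>e n \<omega>\<bar>"] variance_positive[of "\<lambda>\<omega>. \<bar>e n \<omega>\<bar>"] e1[of n] sample(2)[of n]
        by simp
      then have "expectation (\<lambda>\<omega>. \<bar>e n \<omega>\<bar>) \<le> sqrt (expectation (\<lambda>\<omega>. (e n \<omega>)\<^sup>2))"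
        by (rule real_le_rsqrt)
      then show "expectation (\<lambda>\<omega>. \<bar>?Y n \<omega> - W n \<omega>\<bar>) \<le> sqrt (expectation (\<lambda>\<omega>. (e n \<omega>)\<^sup>2) / real n)"
        unfolding Y_eq by (simp add: real_sqrt_divide divide_right_mono)
    qed
    show "\<forall>\<^sub>F n in sequentially. 0 \<le> expectation (\<lambda>\<omega>. \<bar>?Y n \<omega> - W n \<omega>\<bar>)"
      by (intro always_eventually allI Bochner_Integration.integral_nonneg abs_ge_zero)
  qed (rule tendsto_const)
  moreover have "(\<lambda>n. char (distr M borel (W n)) t) \<longlonglongrightarrow> char (normal_law 0 ?v) t" for t
    unfolding W_def
  proof (rule char_normalized_sum_tendsto)
    have "Suc ` UNIV = {1..}"
      by (auto simp: image_iff intro: Suc_le_D)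
    then have "indep_vars (\<lambda>i. count_space UNIV) (\<lambda>i. X (Suc i)) UNIV"
      using indep_vars_reindex_inj[of "\<lambda>_. count_space UNIV" X Suc UNIV] ind by simp
    then show "indep_vars (\<lambda>_. borel) Z UNIV"
      unfolding Z_def[abs_def] by (rule indep_vars_compose2) simp
    have ex: "expectation (\<lambda>\<omega>. f (X (Suc i) \<omega>)) = measure_pmf.expectation p f" for f :: "nat \<Rightarrow> real" and i
      by (subst dX[of i, symmetric], subst integral_distr) auto
    show "expectation (Z n) = 0" for n
      using ex[of "\<lambda>y. a - ln (pmf p y)" n] l1 by (simp add: Z_def[abs_def] a_def)
    show "expectation (\<lambda>\<omega>. (Z n \<omega>)\<^sup>2) = ?v" for n
      using ex[of "\<lambda>y. (a - ln (pmf p y))\<^sup>2" n] by (simp add: Z_def a_def power2_commute)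
    show "integrable M (\<lambda>\<omega>. (Z n \<omega>)\<^sup>2)" for n
    proof -
      have "integrable (measure_pmf p) (\<lambda>y. (a - ln (pmf p y))\<^sup>2)"
        by (intro square_integrable_diff l2) auto
      then have "integrable (distr M (count_space UNIV) (X (Suc n))) (\<lambda>y. (a - ln (pmf p y))\<^sup>2)"
        by (simp only: dX)
      then show ?thesis unfolding Z_def by (subst (asm) integrable_distr_eq) auto
    qed
    show "distr M borel (Z n) = distr (measure_pmf p) borel (\<lambda>y. a - ln (pmf p y))" for n
      by (subst dX[of n, symmetric], subst distr_distr) (auto simp: Z_def[abs_def] o_def)
  qed
  moreover have "integrable M (\<lambda>\<omega>. ?Y n \<omega> - W n \<omega>)" for n
    unfolding Y_eq using e1[of n] by simp
  ultimately have "(\<lambda>n. char (distr M borel (?Y n)) t) \<longlonglongrightarrow> char (normal_law 0 ?v) t" for t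
    by (intro char_distr_tendsto_of_L1_approx[OF Y W])
  \<comment> \<open>Levy's continuity theorem turns pointwise convergence of characteristic
    functions into weak convergence.\<close>
  then show ?thesis
    using Y by (intro levy_continuity real_distribution_normal_law measure_pmf.variance_positive) auto
qed

end
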